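(* Let $\mathcal U$ be a unital nondiscrete subring of $\mathbb R$, and suppose $(A_t)_{0\le t\le 1}$ is a path (continuous in $t$) of positive real $n\times n$ matrices, all in the same conjugacy class over $\mathbb R$, from $A=A_0$ to $B=A_1$. Then the following hold. (1) $A$ and $B$ are SSE over $\mathbb R_+$, through positive $n\times n$ matrices. (2) Suppose $A$ has entries in $\mathcal U$, there is a path $(G_t)_{0\le t\le 1}$ in $\mathrm{GL}(n,\mathbb R)$ such that $G_0=I$ and $G_t^{-1}AG_t=A_t$ for all $t$, and there is a $W\in \mathrm{GL}(n,\mathcal U)$ such that $W^{-1}AW=B$ and $WG_1^{-1}$ is in the connected component of the identity in $\mathrm{Cent}_{\mathbb R}(A)$. Then $A$ and $B$ are SSE over $\mathcal U_+$, through positive $n\times n$ matrices. (3) Suppose $A$ and $B$ have entries in $\mathcal U$ and are conjugate over $\mathcal U$, and every connected component of $\mathrm{Cent}_{\mathbb R}(A)$ contains a matrix from $\mathrm{GL}(n,\mathcal U)$. Then $A$ and $B$ are SSE over $\mathcal U_+$, through positive $n\times n$ matrices. (4) Suppose $A$ and $B$ have entries in $\mathcal U$ and are conjugate over $\mathcal U$, and $\mathcal U$ is a field, or more generally $\mathcal U$ contains an ideal $J\ne \mathcal U$ such that every element of $\mathcal U$ outside $J$ is a unit in $\mathcal U$. Then $A$ and $B$ are SSE over $\mathcal U_+$, through positive $n\times n$ matrices.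
   Context: A matrix is positive if all its entries are positive real numbers. For a subring $\mathcal U$ of $\mathbb R$, $\mathcal U_+=\mathcal U\cap[0,\infty)$. Unital nondiscrete means containing $1$ and dense in $\mathbb R$. Square matrices $A,B$ over a semiring $\mathcal S$ are elementary strong shift equivalent (ESSE) over $\mathcal S$ if there are (possibly rectangular) matrices $R,S$ over $\mathcal S$ with $A=RS$ and $B=SR$. Matrices $A,B$ are SSE over $\mathcal S$, through positive $n\times n$ matrices, if for some $\ell\in\mathbb N$ there are $n\times n$ positive matrices $A=A_0,A_1,\dots,A_\ell=B$ such that $A_{i-1}$ is ESSE over $\mathcal S$ to $A_i$ for $1\le i\le \ell$ (these intermediate matrices are unrelated to the path). Two $n\times n$ matrices $A,B$ are conjugate over $\mathcal U$ if $W^{-1}AW=B$ for some $W\in\mathrm{GL}(n,\mathcal U)$. $\mathrm{Cent}_{\mathbb R}(A)=\{X\in \mathrm{GL}(n,\mathbb R): AX=XA\}$, with the topology inherited from $\mathrm{GL}(n,\mathbb R)$. *)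

theory Defs
  imports "HOL-Analysis.Analysis"
begin

definition subring_of_reals :: "real set \<Rightarrow> bool" where
  "subring_of_reals U \<longleftrightarrow>
     0 \<in> U \<and> (\<forall>x\<in>U. \<forall>y\<in>U. x - y \<in> U) \<and> (\<forall>x\<in>U. \<forall>y\<in>U. x * y \<in> U)"

definition unital_nondiscrete :: "real set \<Rightarrow> bool" where
  "unital_nondiscrete U \<longleftrightarrow> 1 \<in> U \<and> closure U = UNIV"

definition is_unit_in :: "real set \<Rightarrow> real \<Rightarrow> bool" where
  "is_unit_in U x \<longleftrightarrow> x \<in> U \<and> (\<exists>y\<in>U. x * y = 1)"

definition is_ideal_of :: "real set \<Rightarrow> real set \<Rightarrow> bool" where
  "is_ideal_of J U \<longleftrightarrow>
     J \<subseteq> U \<and> 0 \<in> J \<and> (\<forall>x\<in>J. \<forall>y\<in>J. x - y \<in> J) \<and> (\<forall>u\<in>U. \<forall>x\<in>J. u * x \<in> J)"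

definition nonneg_part :: "real set \<Rightarrow> real set" where
  "nonneg_part U = U \<inter> {0..}"

definition matrix_over :: "'a set \<Rightarrow> 'a^'n^'m \<Rightarrow> bool" where
  "matrix_over S A \<longleftrightarrow> (\<forall>i j. A $ i $ j \<in> S)"

definition positive_matrix :: "real^'n^'m \<Rightarrow> bool" where
  "positive_matrix A \<longleftrightarrow> (\<forall>i j. A $ i $ j > 0)"

text \<open>\<open>GL U\<close> is the group of matrices invertible over \<open>U\<close>: the entries of the inverse are
  required to lie in \<open>U\<close> as well. \<open>GL UNIV\<close> is the real general linear group.\<close>

definition GL :: "real set \<Rightarrow> (real^'n^'n) set" where
  "GL U = {W. matrix_over U W \<and> (\<exists>V. matrix_over U V \<and> W ** V = mat 1 \<and> V ** W = mat 1)}"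

definition conjugate_over :: "real set \<Rightarrow> real^'n^'n \<Rightarrow> real^'n^'n \<Rightarrow> bool" where
  "conjugate_over U A B \<longleftrightarrow> (\<exists>W\<in>GL U. matrix_inv W ** A ** W = B)"

definition Cent :: "real^'n^'n \<Rightarrow> (real^'n^'n) set" where
  "Cent A = {X \<in> GL UNIV. A ** X = X ** A}"

text \<open>The sizes of \<open>A\<close> and \<open>B\<close> may differ, in which case \<open>R\<close> and \<open>T\<close> are rectangular;
  their shapes are forced by the two factorizations.\<close>

definition ESSE :: "'a::semiring_1 set \<Rightarrow> 'a^'m^'m \<Rightarrow> 'a^'k^'k \<Rightarrow> bool" where
  "ESSE S A B \<longleftrightarrow> matrix_over S A \<and> matrix_over S B \<and>
     (\<exists>(R :: 'a^'k^'m) (T :: 'a^'m^'k).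
        matrix_over S R \<and> matrix_over S T \<and> A = R ** T \<and> B = T ** R)"

text \<open>Chains have length at least one. Allowing length zero would make no difference for
  matrices over a unital semiring \<open>S\<close>, since \<open>A = A ** mat 1 = mat 1 ** A\<close>.\<close>

definition SSE_through_positive :: "real set \<Rightarrow> real^'n^'n \<Rightarrow> real^'n^'n \<Rightarrow> bool" where
  "SSE_through_positive S A B \<longleftrightarrow>
     (\<exists>(l::nat) C. l \<ge> 1 \<and> C 0 = A \<and> C l = B \<and>
        (\<forall>i\<le>l. positive_matrix (C i)) \<and> (\<forall>i\<in>{1..l}. ESSE S (C (i - 1)) (C i)))"

end

theory Submission
  imports Defs
begin

text \<open>
  Everything rests on moving the conjugator rather than the matrix.  Let \<open>A\<close> be over \<open>U\<close>.  If \<open>X\<close> is a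
  real invertible matrix with \<open>X\<^sup>-\<^sup>1 A X\<close> positive, then any two conjugates \<open>V\<^sup>-\<^sup>1 A V\<close>, \<open>W\<^sup>-\<^sup>1 A W\<close> by elements of \<open>GL U\<close>
  that are sufficiently close to \<open>X\<close> up to positive scalars are joined by two elementary equivalences with
  positive factors over \<open>U\<close> (\<open>conjugates_nearby\<close>).  The intermediate matrix is a further conjugate by
  a small positive perturbation of a scalar matrix; it absorbs the small negative entries of
  \<open>V\<^sup>-\<^sup>1 W\<close>.  Since the matrices \<open>c V\<close> with \<open>c > 0\<close> and \<open>V\<close> in \<open>GL U\<close> are dense in the real general
  linear group (\<open>invertible_in_closure_scaled_GL\<close>), these local links can be chained along any
  connected set of real conjugators that keep \<open>A\<close> positive (\<open>conjugates_in_connected_set\<close>).  Hence \<open>A\<close>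
  and \<open>W\<^sup>-\<^sup>1 A W\<close> are strong shift equivalent whenever such a set contains the identity and an element
  \<open>W\<close> of \<open>GL U\<close>.

  The path of matrices provides a connected set of conjugators from the identity to some \<open>Y\<close> with
  \<open>Y\<^sup>-\<^sup>1 A Y = B\<close>, because matrices in one conjugacy class have continuous local conjugators
  (\<open>continuous_local_conjugators\<close>).  For \<open>U\<close> the reals this already proves the first claim.  A
  conjugator \<open>W\<close> over \<open>U\<close> differs from \<open>Y\<close> by the element \<open>W Y\<^sup>-\<^sup>1\<close> of the centralizer; if that
  element lies in the identity component, the connected set can be extended from \<open>Y\<close> to \<open>W\<close>, and if
  every component contains a matrix from \<open>GL U\<close>, then \<open>W\<close> can be corrected so that it does.  Over a
  field or a local ring every component contains such a matrix
  (\<open>centralizer_component_meets_GL\<close>), since the commutant is cut out by linear equations over \<open>U\<close> and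
  therefore has dense points over \<open>U\<close>.
\<close>

section \<open>Matrix inverses and matrices over a subring\<close>

lemma bounded_bilinear_matrix_mult:
  "bounded_bilinear ((**) :: real^'n^'n \<Rightarrow> real^'n^'n \<Rightarrow> real^'n^'n)"
proof -
  have "bilinear ((**) :: real^'n^'n \<Rightarrow> real^'n^'n \<Rightarrow> real^'n^'n)"
    unfolding bilinear_def
    by (intro conjI allI linearI)
      (simp_all add: matrix_add_ldistrib scalar_matrix_assoc matrix_scalar_ac,
       simp_all add: matrix_matrix_mult_def vec_eq_iff distrib_right sum.distrib)
  then show ?thesis by (simp add: bilinear_conv_bounded_bilinear)
qed

lemmas matrix_mult_add_left = bounded_bilinear.add_left[OF bounded_bilinear_matrix_mult]
  and matrix_mult_diff_left = bounded_bilinear.diff_left[OF bounded_bilinear_matrix_mult]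
  and matrix_mult_diff_right = bounded_bilinear.diff_right[OF bounded_bilinear_matrix_mult]
  and matrix_mult_scaleR_left = bounded_bilinear.scaleR_left[OF bounded_bilinear_matrix_mult]
  and matrix_mult_scaleR_right = bounded_bilinear.scaleR_right[OF bounded_bilinear_matrix_mult]
  and tendsto_matrix_mult = bounded_bilinear.tendsto[OF bounded_bilinear_matrix_mult]

lemma matrix_inv_works:
  fixes A :: "real^'n^'n"
  assumes "det A \<noteq> 0"
  shows "A ** matrix_inv A = mat 1" "matrix_inv A ** A = mat 1"
proof -
  have "\<exists>B. A ** B = mat 1 \<and> B ** A = mat 1"
    using assms by (simp flip: invertible_det_nz add: invertible_def)
  from someI_ex[OF this] show "A ** matrix_inv A = mat 1" "matrix_inv A ** A = mat 1"
    unfolding matrix_inv_def by auto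
qed

lemma matrix_inv_eqI:
  fixes A :: "real^'n^'n"
  assumes "A ** B = mat 1"
  shows "matrix_inv A = B" "det A \<noteq> 0"
proof -
  show d: "det A \<noteq> 0"
    using assms invertible_right_inverse invertible_det_nz by blast
  have "matrix_inv A = matrix_inv A ** (A ** B)" by (simp add: assms)
  also have "\<dots> = B" by (simp only: matrix_mul_assoc matrix_inv_works[OF d] matrix_mul_lid)
  finally show "matrix_inv A = B" .
qed

lemma matrix_inv_mult:
  fixes A B :: "real^'n^'n"
  assumes "det A \<noteq> 0" "det B \<noteq> 0"
  shows "matrix_inv (A ** B) = matrix_inv B ** matrix_inv A"
proof (rule matrix_inv_eqI)
  have "A ** B ** (matrix_inv B ** matrix_inv A) = A ** (B ** matrix_inv B) ** matrix_inv A"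
    by (simp only: matrix_mul_assoc)
  then show "A ** B ** (matrix_inv B ** matrix_inv A) = mat 1"
    by (simp add: matrix_inv_works assms)
qed

lemma det_matrix_inv_nz:
  fixes A :: "real^'n^'n"
  assumes "det A \<noteq> 0"
  shows "det (matrix_inv A) \<noteq> 0"
  using matrix_inv_eqI(2)[OF matrix_inv_works(2)[OF assms]] .

lemma matrix_inv_inv:
  fixes A :: "real^'n^'n"
  assumes "det A \<noteq> 0"
  shows "matrix_inv (matrix_inv A) = A"
  using matrix_inv_eqI(1)[OF matrix_inv_works(2)[OF assms]] .

lemma matrix_inv_scaleR:
  fixes A :: "real^'n^'n"
  assumes "det A \<noteq> 0" "c \<noteq> 0"
  shows "matrix_inv (c *\<^sub>R A) = (1/c) *\<^sub>R matrix_inv A"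
  by (rule matrix_inv_eqI)
    (simp add: matrix_mult_scaleR_left matrix_mult_scaleR_right matrix_inv_works assms)

lemma matrix_mult_cancel:
  fixes A X :: "real^'n^'n"
  assumes "det A \<noteq> 0"
  shows "A ** (matrix_inv A ** X) = X" "matrix_inv A ** (A ** X) = X"
    "X ** A ** matrix_inv A = X" "X ** matrix_inv A ** A = X"
  by (simp_all add: matrix_mul_assoc matrix_inv_works assms)
    (simp_all add: matrix_mul_assoc[symmetric] matrix_inv_works assms)

lemma conjugate_eq_iff:
  fixes A B W :: "real^'n^'n"
  assumes "det W \<noteq> 0"
  shows "matrix_inv W ** A ** W = B \<longleftrightarrow> A ** W = W ** B"
  by (metis assms matrix_mult_cancel(1,2) matrix_mul_assoc)

text \<open>Cramer's rule solves \<open>A *v x = axis j 1\<close> for the columns of the inverse.  It gives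
  both the continuity of inversion and the integrality of an inverse whose determinant is a
  unit.\<close>

lemma matrix_inv_cramer:
  fixes A :: "real^'n^'n"
  assumes "det A \<noteq> 0"
  shows "matrix_inv A $ k $ j =
    det (\<chi> i l. if l = k then (if i = j then 1 else 0) else A $ i $ l) / det A"
proof -
  have "A *v (matrix_inv A *v axis j 1) = axis j 1"
    by (simp add: matrix_vector_mul_assoc matrix_inv_works assms)
  then have "(matrix_inv A *v axis j 1) $ k =
      det (\<chi> i l. if l = k then axis j 1 $ i else A $ i $ l) / det A"
    by (rule arg_cong[OF iffD1[OF cramer[OF assms]], where f = "\<lambda>x. x $ k", simplified vec_lambda_beta])
  moreover have "(matrix_inv A *v axis j 1) $ k = matrix_inv A $ k $ j"
    by (simp add: matrix_vector_mult_basis column_def)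
  moreover have "(axis j 1 :: real^'n) $ i = (if i = j then 1 else 0)" for i
    by (simp add: axis_def)
  ultimately show ?thesis by (simp cong: if_cong)
qed

lemma tendsto_det:
  fixes f :: "'b \<Rightarrow> real^'n^'n"
  assumes "(f \<longlongrightarrow> A) F"
  shows "((\<lambda>x. det (f x)) \<longlongrightarrow> det A) F"
  unfolding det_def by (intro tendsto_intros assms)

lemma tendsto_matrix_inv:
  fixes f :: "'b \<Rightarrow> real^'n^'n"
  assumes f: "(f \<longlongrightarrow> A) F" and A: "det A \<noteq> 0"
  shows "((\<lambda>x. matrix_inv (f x)) \<longlongrightarrow> matrix_inv A) F"
proof (intro vec_tendstoI)
  fix k j
  let ?c = "\<lambda>A::real^'n^'n. \<chi> i l. if l = k then (if i = j then 1 else 0) else A $ i $ l"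
  have "eventually (\<lambda>x. det (f x) \<noteq> 0) F"
    using tendsto_imp_eventually_ne[OF tendsto_det[OF f] A] .
  then have ev: "eventually (\<lambda>x. det (?c (f x)) / det (f x) = matrix_inv (f x) $ k $ j) F"
    by eventually_elim (simp add: matrix_inv_cramer)
  have "((\<lambda>x. ?c (f x)) \<longlongrightarrow> ?c A) F"
  proof (intro vec_tendstoI)
    fix i l
    show "((\<lambda>x. ?c (f x) $ i $ l) \<longlongrightarrow> ?c A $ i $ l) F"
      by (auto intro!: tendsto_intros f)
  qed
  then have "((\<lambda>x. det (?c (f x)) / det (f x)) \<longlongrightarrow> det (?c A) / det A) F"
    by (intro tendsto_divide tendsto_det f A)
  then show "((\<lambda>x. matrix_inv (f x) $ k $ j) \<longlongrightarrow> matrix_inv A $ k $ j) F"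
    using ev by (simp add: matrix_inv_cramer[OF A] tendsto_cong)
qed

lemma eventually_positive_matrix:
  fixes f :: "'b \<Rightarrow> real^'n^'n"
  assumes f: "(f \<longlongrightarrow> A) F" and A: "positive_matrix A"
  shows "eventually (\<lambda>x. positive_matrix (f x)) F"
  unfolding positive_matrix_def eventually_all_finite
proof (intro eventually_all_finite)
  fix i j
  have "((\<lambda>x. f x $ i $ j) \<longlongrightarrow> A $ i $ j) F" by (intro tendsto_intros f)
  moreover have "0 < A $ i $ j" using A by (simp add: positive_matrix_def)
  ultimately show "eventually (\<lambda>x. 0 < f x $ i $ j) F" by (rule order_tendstoD)
qed

lemma positive_matrix_mult:
  assumes "positive_matrix A" "positive_matrix B"
  shows "positive_matrix (A ** B)"
  using assms unfolding positive_matrix_def matrix_matrix_mult_def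
  by (auto intro!: sum_pos)

lemma positive_matrix_scaleR:
  "c > 0 \<Longrightarrow> positive_matrix (c *\<^sub>R A) \<longleftrightarrow> positive_matrix A"
  by (auto simp: positive_matrix_def zero_less_mult_iff)

lemma GL_UNIV_iff: "W \<in> GL UNIV \<longleftrightarrow> det W \<noteq> 0"
  unfolding GL_def matrix_over_def
  by (simp flip: invertible_det_nz add: invertible_def)

lemma GL_iff: "W \<in> GL U \<longleftrightarrow> matrix_over U W \<and> det W \<noteq> 0 \<and> matrix_over U (matrix_inv W)"
proof
  assume "W \<in> GL U"
  then show "matrix_over U W \<and> det W \<noteq> 0 \<and> matrix_over U (matrix_inv W)"
    using matrix_inv_eqI unfolding GL_def by blast
next
  assume "matrix_over U W \<and> det W \<noteq> 0 \<and> matrix_over U (matrix_inv W)"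
  then show "W \<in> GL U"
    using matrix_inv_works unfolding GL_def by blast
qed

lemma GL_det_nz: "W \<in> GL U \<Longrightarrow> det W \<noteq> 0"
  by (simp add: GL_iff)

lemma subring_add:
  assumes "subring_of_reals U" "x \<in> U" "y \<in> U"
  shows "x + y \<in> U"
proof -
  have "0 - y \<in> U" using assms unfolding subring_of_reals_def by blast
  then have "x - (0 - y) \<in> U" using assms unfolding subring_of_reals_def by blast
  then show ?thesis by simp
qed

lemma subring_minus: "subring_of_reals U \<Longrightarrow> x \<in> U \<Longrightarrow> - x \<in> U"
  unfolding subring_of_reals_def by (metis diff_0)

lemma subring_mult: "subring_of_reals U \<Longrightarrow> x \<in> U \<Longrightarrow> y \<in> U \<Longrightarrow> x * y \<in> U"
  unfolding subring_of_reals_def by blast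

lemma subring_sum:
  assumes U: "subring_of_reals U" and "\<And>i. i \<in> I \<Longrightarrow> f i \<in> U"
  shows "sum f I \<in> U"
proof -
  have "0 \<in> U" using U by (simp add: subring_of_reals_def)
  then show ?thesis
    using assms(2) by (induction I rule: infinite_finite_induct) (auto intro: subring_add[OF U])
qed

lemma subring_prod:
  assumes U: "subring_of_reals U" "1 \<in> U" and "\<And>i. i \<in> I \<Longrightarrow> f i \<in> U"
  shows "prod f I \<in> U"
  using assms(3)
  by (induction I rule: infinite_finite_induct) (auto intro: subring_mult[OF U(1)] U(2))

lemma matrix_over_mult:
  assumes "subring_of_reals U" "matrix_over U A" "matrix_over U B"
  shows "matrix_over U (A ** B)"
  using assms unfolding matrix_over_def matrix_matrix_mult_def
  by (auto intro!: subring_sum subring_mult)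

lemma GL_mult:
  assumes U: "subring_of_reals U" and "A \<in> GL U" "B \<in> GL U"
  shows "A ** B \<in> GL U"
  using assms by (auto simp: GL_iff matrix_inv_mult det_mul intro!: matrix_over_mult[OF U])

lemma matrix_over_mat_1: "subring_of_reals U \<Longrightarrow> 1 \<in> U \<Longrightarrow> matrix_over U (mat 1)"
  by (auto simp: matrix_over_def mat_def subring_of_reals_def)

lemma mat_1_in_GL: "subring_of_reals U \<Longrightarrow> 1 \<in> U \<Longrightarrow> mat 1 \<in> GL U"
  by (auto simp: GL_def intro!: matrix_over_mat_1 exI[of _ "mat 1"])

lemma det_in_subring:
  assumes U: "subring_of_reals U" "1 \<in> U" and A: "matrix_over U A"
  shows "det A \<in> U"
proof -
  have s: "of_int (sign p) \<in> U" for p :: "'a \<Rightarrow> 'a"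
    using U by (auto simp: sign_def subring_minus)
  show ?thesis
    unfolding det_def using A s
    by (intro subring_sum subring_mult subring_prod U) (auto simp: matrix_over_def)
qed

section \<open>Density of the scaled general linear group\<close>

text \<open>Positive scalars cancel in a conjugation \<open>V\<^sup>-\<^sup>1 A V\<close>, so multiplying a conjugator by one changes
  nothing.  They are adjoined because \<open>GL U\<close> itself need not be dense: determinants of its elements
  are units of \<open>U\<close>, and these may form a discrete set; the positive scalars supply the missing absolute
  values of determinants.\<close>

definition scaled_GL :: "real set \<Rightarrow> (real^'n^'n) set" where
  "scaled_GL U = {c *\<^sub>R V | c V. c > 0 \<and> V \<in> GL U}"

definition transvection :: "'n \<Rightarrow> 'n \<Rightarrow> real \<Rightarrow> real^'n^'n" where
  "transvection m n c = (\<chi> i j. if i = m \<and> j = n then c else of_bool (i = j))"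

definition diag_matrix :: "('n \<Rightarrow> real) \<Rightarrow> real^'n^'n" where
  "diag_matrix d = (\<chi> i j. if i = j then d i else 0)"

lemma transvection_mult:
  assumes "m \<noteq> n"
  shows "(transvection m n c ** M) $ i $ j = M $ i $ j + (if i = m then c * M $ n $ j else 0)"
proof -
  have "(transvection m n c ** M) $ i $ j =
      (\<Sum>k\<in>UNIV. (if k = i then M $ k $ j else 0) + (if k = n then (if i = m then c * M $ k $ j else 0) else 0))"
    unfolding matrix_matrix_mult_def transvection_def using assms
    by (auto intro!: sum.cong)
  then show ?thesis by (simp add: sum.distrib)
qed

lemma transvection_in_GL:
  assumes U: "subring_of_reals U" "1 \<in> U" and "c \<in> U" "m \<noteq> n"
  shows "transvection m n c \<in> GL U"
proof -
  have inv: "transvection m n x ** transvection m n (-x) = (mat 1 :: real^'a^'a)" for x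
    using \<open>m \<noteq> n\<close>
    by (simp add: vec_eq_iff transvection_mult) (auto simp: transvection_def mat_def)
  have "matrix_over U (transvection m n x)" if "x \<in> U" for x
    using that U by (auto simp: matrix_over_def transvection_def subring_of_reals_def)
  then show ?thesis
    using inv[of c] inv[of "-c"] assms subring_minus
    unfolding GL_def by (auto intro!: exI[of _ "transvection m n (-c)"])
qed

lemma diag_matrix_mult: "diag_matrix d ** diag_matrix e = diag_matrix (\<lambda>i. d i * e i)"
  unfolding diag_matrix_def matrix_matrix_mult_def vec_eq_iff
  by (auto simp: if_distrib[of "\<lambda>x. x * _"] cong: if_cong)

lemma diag_matrix_scaleR: "c *\<^sub>R diag_matrix d = diag_matrix (\<lambda>i. c * d i)"
  by (auto simp: diag_matrix_def vec_eq_iff)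

text \<open>Whitehead's identity in the coordinates \<open>k, j\<close>.  It reduces diagonal matrices with product
  \<open>1\<close> to transvections, which density of \<open>U\<close> can approximate: a diagonal entry cannot be
  approximated directly, since it would have to be a unit of \<open>U\<close>.\<close>

lemma diag_matrix_whitehead:
  assumes "k \<noteq> j" "a \<noteq> 0"
  shows "diag_matrix (\<lambda>i. if i = k then a else if i = j then 1/a else 1) =
    transvection k j a ** (transvection j k (-1/a) ** (transvection k j (a - 1) **
      (transvection j k 1 ** transvection k j (-1))))"
  using assms
  by (simp add: vec_eq_iff transvection_mult)
     (auto simp: transvection_def diag_matrix_def field_simps)

lemma scaled_GL_mult:
  assumes U: "subring_of_reals U" and "X \<in> scaled_GL U" "Y \<in> scaled_GL U"
  shows "X ** Y \<in> scaled_GL U"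
proof -
  obtain c V d W where *: "X = c *\<^sub>R V" "c > 0" "V \<in> GL U" "Y = d *\<^sub>R W" "d > 0" "W \<in> GL U"
    using assms(2,3) by (auto simp: scaled_GL_def)
  have "X ** Y = (c * d) *\<^sub>R (V ** W)"
    using * by (simp add: matrix_mult_scaleR_left matrix_mult_scaleR_right)
  moreover have "V ** W \<in> GL U" using * GL_mult[OF U] by blast
  moreover have "c * d > 0" using * by simp
  ultimately show ?thesis unfolding scaled_GL_def by blast
qed

lemma closure_scaled_GL_mult:
  assumes U: "subring_of_reals U"
    and X: "X \<in> closure (scaled_GL U)" and Y: "Y \<in> closure (scaled_GL U)"
  shows "X ** Y \<in> closure (scaled_GL U)"
proof -
  obtain f where f: "\<And>n. f n \<in> scaled_GL U" "f \<longlonglongrightarrow> X"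
    using X unfolding closure_sequential by blast
  obtain g where g: "\<And>n. g n \<in> scaled_GL U" "g \<longlonglongrightarrow> Y"
    using Y unfolding closure_sequential by blast
  have "(\<lambda>n. f n ** g n) \<longlonglongrightarrow> X ** Y"
    by (intro tendsto_matrix_mult f g)
  then show ?thesis
    unfolding closure_sequential using scaled_GL_mult[OF U f(1) g(1)]
    by (intro exI[of _ "\<lambda>n. f n ** g n"]) auto
qed

lemma GL_subset_closure_scaled_GL:
  assumes "V \<in> GL U"
  shows "V \<in> closure (scaled_GL U)"
proof -
  have "V = 1 *\<^sub>R V" by simp
  then have "V \<in> scaled_GL U" using assms unfolding scaled_GL_def by (auto intro!: exI[of _ "1::real"])
  then show ?thesis using closure_subset by blast
qed

lemma transvection_in_closure:
  assumes U: "subring_of_reals U" "unital_nondiscrete U" and mn: "m \<noteq> n"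
  shows "transvection m n x \<in> closure (scaled_GL U)"
proof -
  have one: "1 \<in> U" and cl: "x \<in> closure U"
    using U(2) by (auto simp: unital_nondiscrete_def)
  obtain u where u: "\<And>k. u k \<in> U" "u \<longlonglongrightarrow> x"
    using cl unfolding closure_sequential by blast
  have "(\<lambda>k. transvection m n (u k)) \<longlonglongrightarrow> transvection m n x"
  proof (intro vec_tendstoI)
    fix i j
    show "(\<lambda>k. transvection m n (u k) $ i $ j) \<longlonglongrightarrow> transvection m n x $ i $ j"
      using u(2) mn by (cases "i = m \<and> j = n") (auto simp: transvection_def)
  qed
  then have "transvection m n x \<in> closure (GL U)"
    unfolding closure_sequential using transvection_in_GL[OF U(1) one u(1) mn]
    by (intro exI[of _ "\<lambda>k. transvection m n (u k)"]) auto
  then show ?thesis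
    using closure_minimal[of "GL U" "closure (scaled_GL U)"] GL_subset_closure_scaled_GL by blast
qed

text \<open>Induction on the support: one Whitehead factor moves the entry at \<open>j\<close> onto the pivot \<open>k\<close>, and
  the remaining diagonal matrix has smaller support and still has product \<open>1\<close>.\<close>

lemma diag_matrix_prod_1_in_closure:
  assumes U: "subring_of_reals U" "unital_nondiscrete U"
    and "finite S" "k \<notin> S" "\<And>i. d i > 0" "\<And>i. i \<notin> insert k S \<Longrightarrow> d i = 1"
      "(\<Prod>i\<in>insert k S. d i) = 1"
  shows "diag_matrix d \<in> closure (scaled_GL U)"
  using assms(3-)
proof (induction S arbitrary: d rule: finite_induct)
  case empty
  then have "d i = 1" for i by (cases "i = k") auto
  then have "diag_matrix d = mat 1"
    by (auto simp: diag_matrix_def mat_def vec_eq_iff)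
  then show ?case
    using GL_subset_closure_scaled_GL mat_1_in_GL U by (metis unital_nondiscrete_def)
next
  case (insert j S)
  define d' where "d' = d(j := 1, k := d k * d j)"
  let ?h = "\<lambda>i. if i = k then 1 / d j else if i = j then 1 / (1 / d j) else 1"
  have kj: "k \<noteq> j" "k \<notin> S" and dj: "d j > 0" using insert.prems by auto
  have "(\<Prod>i\<in>S. d' i) = (\<Prod>i\<in>S. d i)"
    using kj insert.hyps by (intro prod.cong) (auto simp: d'_def)
  then have "diag_matrix d' \<in> closure (scaled_GL U)"
    using insert.prems insert.hyps kj
    by (intro insert.IH) (auto simp: d'_def mult_ac)
  moreover have "diag_matrix ?h \<in> closure (scaled_GL U)"
    using kj dj by (subst diag_matrix_whitehead)
      (auto intro!: closure_scaled_GL_mult transvection_in_closure U)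
  moreover have "d = (\<lambda>i. ?h i * d' i)"
    using kj dj by (auto simp: d'_def)
  then have "diag_matrix d = diag_matrix ?h ** diag_matrix d'"
    by (subst diag_matrix_mult) (rule arg_cong[where f = diag_matrix])
  ultimately show ?case
    using closure_scaled_GL_mult[OF U(1)] by simp
qed

lemma diag_matrix_in_closure:
  fixes d :: "'n::finite \<Rightarrow> real"
  assumes U: "subring_of_reals U" "unital_nondiscrete U" and d: "\<And>i. d i \<noteq> 0"
  shows "diag_matrix d \<in> closure (scaled_GL U)"
proof -
  have one: "1 \<in> U" using U(2) by (simp add: unital_nondiscrete_def)
  \<comment> \<open>split off the signs, which lie in \<open>GL U\<close>, and the scalar \<open>c\<close> that makes the product 1\<close>
  define p where "p = (\<Prod>i\<in>UNIV. \<bar>d i\<bar>)"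
  have p: "p > 0" unfolding p_def using d by (intro prod_pos) auto
  define c where "c = root CARD('n) p"
  have c: "c > 0" "c ^ CARD('n) = p" using p by (auto simp: c_def real_root_pow_pos2)
  have sgn: "diag_matrix (\<lambda>i. sgn (d i)) \<in> GL U"
  proof -
    have "sgn (d i) * sgn (d i) = 1" for i using d by (simp add: sgn_if)
    then have "diag_matrix (\<lambda>i. sgn (d i)) ** diag_matrix (\<lambda>i. sgn (d i)) = mat 1"
      by (simp add: diag_matrix_mult) (simp add: diag_matrix_def mat_def)
    moreover have "matrix_over U (diag_matrix (\<lambda>i. sgn (d i)))"
      using U one subring_minus[OF U(1) one]
      by (auto simp: matrix_over_def diag_matrix_def sgn_if subring_of_reals_def)
    ultimately show ?thesis by (auto simp: GL_def)
  qed
  have scalar: "c *\<^sub>R mat 1 \<in> scaled_GL U"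
    using c mat_1_in_GL[OF U(1) one] by (auto simp: scaled_GL_def)
  have "diag_matrix (\<lambda>i. \<bar>d i\<bar> / c) \<in> closure (scaled_GL U)"
  proof (rule diag_matrix_prod_1_in_closure[OF U, of "UNIV - {undefined}" undefined])
    have "(\<Prod>i\<in>UNIV. \<bar>d i\<bar> / c) = 1"
      using c(1) p by (simp add: prod_dividef c(2) flip: p_def)
    then show "(\<Prod>i\<in>insert undefined (UNIV - {undefined}). \<bar>d i\<bar> / c) = 1"
      by (simp add: insert_absorb)
  qed (use c d in auto)
  then have "diag_matrix (\<lambda>i. sgn (d i)) ** ((c *\<^sub>R mat 1) ** diag_matrix (\<lambda>i. \<bar>d i\<bar> / c))
      \<in> closure (scaled_GL U)"
    using GL_subset_closure_scaled_GL[OF sgn] subsetD[OF closure_subset scalar]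
    by (intro closure_scaled_GL_mult[OF U(1)])
  moreover have "diag_matrix (\<lambda>i. sgn (d i)) ** ((c *\<^sub>R mat 1) ** diag_matrix (\<lambda>i. \<bar>d i\<bar> / c)) = diag_matrix d"
    using c by (simp add: matrix_mult_scaleR_left diag_matrix_scaleR diag_matrix_mult sgn_mult_abs)
  ultimately show ?thesis by simp
qed

text \<open>The closure is closed under products, so it is enough to treat the elementary matrices: swaps lie in
  \<open>GL U\<close>, transvections are limits of transvections over \<open>U\<close>, and diagonal matrices were
  reduced to transvections.\<close>

lemma invertible_in_closure_scaled_GL:
  fixes X :: "real^'n^'n"
  assumes U: "subring_of_reals U" "unital_nondiscrete U" and "det X \<noteq> 0"
  shows "X \<in> closure (scaled_GL U)"
proof -
  have one: "1 \<in> U" using U(2) by (simp add: unital_nondiscrete_def)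
  have "det X \<noteq> 0 \<longrightarrow> X \<in> closure (scaled_GL U)"
  proof (rule induct_matrix_elementary[where P = "\<lambda>X. det X \<noteq> 0 \<longrightarrow> X \<in> closure (scaled_GL U)"])
    show "det (A ** B) \<noteq> 0 \<longrightarrow> A ** B \<in> closure (scaled_GL U)"
      if "det A \<noteq> 0 \<longrightarrow> A \<in> closure (scaled_GL U)" "det B \<noteq> 0 \<longrightarrow> B \<in> closure (scaled_GL U)"
      for A B :: "real^'n^'n"
      using that by (auto simp: det_mul intro: closure_scaled_GL_mult[OF U(1)])
  next
    show "det A \<noteq> 0 \<longrightarrow> A \<in> closure (scaled_GL U)" if "row i A = 0" for A :: "real^'n^'n" and i
      using that by (simp add: det_zero_row)
  next
    fix A :: "real^'n^'n"
    assume diagonal: "\<And>i j. i \<noteq> j \<Longrightarrow> A $ i $ j = 0"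
    then have "A = diag_matrix (\<lambda>i. A $ i $ i)"
      by (auto simp: diag_matrix_def vec_eq_iff)
    moreover have "A $ i $ i \<noteq> 0" if "det A \<noteq> 0" for i
      using that diagonal by (auto simp: det_diagonal)
    ultimately show "det A \<noteq> 0 \<longrightarrow> A \<in> closure (scaled_GL U)"
      using diag_matrix_in_closure[OF U, of "\<lambda>i. A $ i $ i"] by metis
  next
    fix m n :: 'n
    define P :: "real^'n^'n" where "P = (\<chi> i j. mat 1 $ i $ Transposition.transpose m n j)"
    have entry: "P $ i $ j = (if j = Transposition.transpose m n i then 1 else 0)" for i j
      by (auto simp: P_def mat_def)
    have "(P ** P) $ i $ j = (\<Sum>k\<in>UNIV. P $ i $ k * P $ k $ j)" for i j
      by (simp add: matrix_matrix_mult_def)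
    also have "(\<Sum>k\<in>UNIV. P $ i $ k * P $ k $ j) = P $ (Transposition.transpose m n i) $ j" for i j
      by (simp add: entry[of i] if_distrib[of "\<lambda>x. x * _"] cong: if_cong)
    finally have "P ** P = mat 1"
      unfolding vec_eq_iff entry by (auto simp: mat_def)
    moreover have "matrix_over U P"
      using U one by (auto simp: matrix_over_def entry subring_of_reals_def)
    ultimately have "P \<in> GL U" by (auto simp: GL_def)
    then show "det (\<chi> i j. mat 1 $ i $ Transposition.transpose m n j :: real^'n^'n) \<noteq> 0 \<longrightarrow>
        (\<chi> i j. mat 1 $ i $ Transposition.transpose m n j) \<in> closure (scaled_GL U)"
      unfolding P_def using GL_subset_closure_scaled_GL by blast
  next
    fix m n :: 'n and c
    assume "m \<noteq> n"
    let ?T = "\<chi> i j. if i = m \<and> j = n then c else of_bool (i = j) :: real^'n^'n"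
    show "det ?T \<noteq> 0 \<longrightarrow> ?T \<in> closure (scaled_GL U)"
      using transvection_in_closure[OF U \<open>m \<noteq> n\<close>, of c] by (simp add: transvection_def)
  qed
  then show ?thesis using assms by blast
qed

section \<open>Strong shift equivalence along a connected set of conjugators\<close>

definition pos_ESSE :: "real set \<Rightarrow> real^'n^'n \<Rightarrow> real^'n^'n \<Rightarrow> bool" where
  "pos_ESSE S A B \<longleftrightarrow> positive_matrix A \<and> positive_matrix B \<and> ESSE S A B"

lemma SSE_through_positive_if_tranclp:
  assumes "(pos_ESSE S)\<^sup>+\<^sup>+ A B"
  shows "SSE_through_positive S A B"
  using assms
proof (induction rule: tranclp_induct)
  case (base B)
  then show ?case
    unfolding SSE_through_positive_def pos_ESSE_def
    by (intro exI[of _ 1] exI[of _ "\<lambda>i::nat. if i = 0 then A else B"]) auto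
next
  case (step B D)
  obtain l :: nat and C where C: "l \<ge> 1" "C 0 = A" "C l = B" "\<forall>i\<le>l. positive_matrix (C i)"
      "\<forall>i\<in>{1..l}. ESSE S (C (i - 1)) (C i)"
    using step.IH unfolding SSE_through_positive_def by blast
  let ?C = "C(Suc l := D)"
  have "positive_matrix (?C i)" if "i \<le> Suc l" for i
    using that C step.hyps(2) by (auto simp: pos_ESSE_def le_Suc_eq)
  moreover have "ESSE S (?C (i - 1)) (?C i)" if "i \<in> {1..Suc l}" for i
    using that C step.hyps(2) by (cases "i = Suc l") (auto simp: pos_ESSE_def)
  ultimately show ?case
    unfolding SSE_through_positive_def using C
    by (intro exI[of _ "Suc l"] exI[of _ ?C]) auto
qed

lemma tranclp_pos_ESSE_sym:
  assumes "(pos_ESSE S)\<^sup>+\<^sup>+ A B"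
  shows "(pos_ESSE S)\<^sup>+\<^sup>+ B A"
proof -
  have sym: "pos_ESSE S Y X" if "pos_ESSE S X Y" for X Y :: "real^'n^'n"
    using that unfolding pos_ESSE_def ESSE_def by blast
  show ?thesis
    using assms
    by (induction rule: tranclp_induct) (blast intro: sym tranclp_into_tranclp2)+
qed

text \<open>Every elementary equivalence constructed below has this form, with both factors positive.\<close>

lemma pos_ESSE_positive_factors:
  assumes U: "subring_of_reals U"
    and "matrix_over U R" "matrix_over U T" "positive_matrix R" "positive_matrix T"
  shows "pos_ESSE (nonneg_part U) (R ** T) (T ** R)"
proof -
  have nn: "matrix_over (nonneg_part U) X" if "matrix_over U X" "positive_matrix X" for X :: "real^'n^'n"
    using that by (auto simp: matrix_over_def positive_matrix_def nonneg_part_def less_imp_le)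
  have "positive_matrix (R ** T)" "positive_matrix (T ** R)"
    using assms by (auto intro: positive_matrix_mult)
  then show ?thesis
    using assms unfolding pos_ESSE_def ESSE_def
    by (intro conjI exI[of _ R] exI[of _ T] nn matrix_over_mult[OF U]) auto
qed

text \<open>A positive \<open>F\<close> so close to a scalar matrix that \<open>M F\<^sup>-\<^sup>1\<close> stays positive.  Perturbing the
  identity by a small multiple of the all-ones matrix gives such a matrix over the reals; both
  conditions are open and invariant under positive scaling, so density provides one in \<open>GL U\<close>.\<close>

lemma positive_mult_GL_inverse:
  fixes M :: "real^'n^'n"
  assumes U: "subring_of_reals U" "unital_nondiscrete U" and M: "positive_matrix M"
  obtains F where "F \<in> GL U" "positive_matrix F" "positive_matrix (M ** matrix_inv F)"
proof -
  define J :: "real^'n^'n" where "J = (\<chi> i j. 1)"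
  define E where "E \<epsilon> = mat 1 + \<epsilon> *\<^sub>R J" for \<epsilon>
  have "(E \<longlongrightarrow> mat 1 + 0 *\<^sub>R J) (at_right 0)"
    unfolding E_def by (intro tendsto_intros)
  then have E: "(E \<longlongrightarrow> mat 1) (at_right 0)" by simp
  have "((\<lambda>\<epsilon>. M ** matrix_inv (E \<epsilon>)) \<longlongrightarrow> M ** matrix_inv (mat 1)) (at_right 0)"
    by (intro tendsto_matrix_mult tendsto_const tendsto_matrix_inv E) simp
  moreover have "matrix_inv (mat 1) = (mat 1 :: real^'n^'n)"
    by (rule matrix_inv_eqI) simp
  ultimately have "((\<lambda>\<epsilon>. M ** matrix_inv (E \<epsilon>)) \<longlongrightarrow> M) (at_right 0)" by simp
  from eventually_positive_matrix[OF this M] tendsto_imp_eventually_ne[OF tendsto_det[OF E], of 0]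
  have "eventually (\<lambda>\<epsilon>. positive_matrix (M ** matrix_inv (E \<epsilon>)) \<and> det (E \<epsilon>) \<noteq> 0 \<and> \<epsilon> > 0) (at_right 0)"
    by (simp add: eventually_conj_iff eventually_at_right_less)
  then obtain \<epsilon> where \<epsilon>: "positive_matrix (M ** matrix_inv (E \<epsilon>))" "det (E \<epsilon>) \<noteq> 0" "\<epsilon> > 0"
    using eventually_happens' trivial_limit_at_right_real by blast
  have "positive_matrix (E \<epsilon>)"
    using \<epsilon>(3) by (auto simp: positive_matrix_def E_def J_def mat_def)
  then have 1: "eventually positive_matrix (nhds (E \<epsilon>))"
    by (intro eventually_positive_matrix[OF filterlim_ident])
  have "((\<lambda>Y. M ** matrix_inv Y) \<longlongrightarrow> M ** matrix_inv (E \<epsilon>)) (nhds (E \<epsilon>))"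
    by (intro tendsto_matrix_mult tendsto_const tendsto_matrix_inv filterlim_ident \<epsilon>)
  from eventually_positive_matrix[OF this \<epsilon>(1)] 1
  have "eventually (\<lambda>Y. positive_matrix Y \<and> positive_matrix (M ** matrix_inv Y)) (nhds (E \<epsilon>))"
    by (rule eventually_conj[rotated])
  then obtain N where N: "open N" "E \<epsilon> \<in> N"
      "\<forall>Y\<in>N. positive_matrix Y \<and> positive_matrix (M ** matrix_inv Y)"
    unfolding eventually_nhds by blast
  then obtain c F where F: "c > 0" "F \<in> GL U" "c *\<^sub>R F \<in> N"
    using invertible_in_closure_scaled_GL[OF U \<epsilon>(2)] open_Int_closure_eq_empty[OF N(1), of "scaled_GL U"]
    unfolding scaled_GL_def by blast
  then have "positive_matrix (c *\<^sub>R F)" "positive_matrix (M ** matrix_inv (c *\<^sub>R F))"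
    using N by auto
  then have "positive_matrix F" "positive_matrix (M ** matrix_inv F)"
    using F by (auto simp: positive_matrix_scaleR matrix_inv_scaleR GL_det_nz matrix_mult_scaleR_right)
  then show thesis using that F by blast
qed

text \<open>The heart of the argument.  Write \<open>M = V\<^sup>-\<^sup>1 A V\<close> and \<open>M' = W\<^sup>-\<^sup>1 A W\<close> with \<open>V\<close> and \<open>W\<close> close
  up to scalars.  Conjugating \<open>M\<close> by \<open>V\<^sup>-\<^sup>1 W\<close> directly need not factor through nonnegative matrices,
  because \<open>V\<^sup>-\<^sup>1 W\<close> is only near a scalar matrix and its small entries may be negative.  A detour
  through \<open>F M F\<^sup>-\<^sup>1\<close>, for a fixed positive \<open>F\<close>, repairs this:
  \<open>M = (M F\<^sup>-\<^sup>1) F\<close> and \<open>F M F\<^sup>-\<^sup>1 = F (M F\<^sup>-\<^sup>1)\<close>, and then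
  \<open>F M F\<^sup>-\<^sup>1 = (F V\<^sup>-\<^sup>1 W) (W\<^sup>-\<^sup>1 A V F\<^sup>-\<^sup>1)\<close> while the factors in reverse order give \<open>M'\<close>.
  At \<open>V = W = X\<close> the four factors are \<open>M F\<^sup>-\<^sup>1\<close>, \<open>F\<close>, \<open>F\<close> and \<open>M F\<^sup>-\<^sup>1\<close>, which are positive, so
  they remain positive nearby.  All four are over \<open>U\<close> as soon as \<open>V\<close> and \<open>W\<close> lie in \<open>GL U\<close>.\<close>

lemma conjugates_nearby:
  fixes A X :: "real^'n^'n"
  assumes U: "subring_of_reals U" "unital_nondiscrete U" and A: "matrix_over U A"
    and X: "det X \<noteq> 0" "positive_matrix (matrix_inv X ** A ** X)"
  obtains N where "open N" "X \<in> N"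
    "\<And>c V d W. \<lbrakk>c > 0; d > 0; V \<in> GL U; W \<in> GL U; c *\<^sub>R V \<in> N; d *\<^sub>R W \<in> N\<rbrakk> \<Longrightarrow>
       (pos_ESSE (nonneg_part U))\<^sup>+\<^sup>+ (matrix_inv V ** A ** V) (matrix_inv W ** A ** W)"
proof -
  obtain F where F: "F \<in> GL U" "positive_matrix F" "positive_matrix (matrix_inv X ** A ** X ** matrix_inv F)"
    using positive_mult_GL_inverse[OF U X(2)] .
  have dF: "det F \<noteq> 0" using F GL_det_nz by blast
  \<comment> \<open>positivity of the factors, as an open condition on the pair of real conjugators\<close>
  define P where "P = (\<lambda>(Y, Z :: real^'n^'n). positive_matrix (matrix_inv Y ** A ** Y ** matrix_inv F)
      \<and> positive_matrix (F ** matrix_inv Y ** Z)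
      \<and> positive_matrix (matrix_inv Z ** A ** Y ** matrix_inv F))"
  let ?N = "nhds X \<times>\<^sub>F nhds X"
  have fst: "(fst \<longlongrightarrow> X) ?N" and snd: "(snd \<longlongrightarrow> X) ?N"
    by (rule filterlim_fst filterlim_snd)+
  have "eventually P ?N"
    unfolding P_def case_prod_unfold
  proof (intro eventually_conj)
    have "((\<lambda>p. matrix_inv (fst p) ** A ** fst p ** matrix_inv F) \<longlongrightarrow> matrix_inv X ** A ** X ** matrix_inv F) ?N"
      by (intro tendsto_matrix_mult tendsto_matrix_inv tendsto_const fst X)
    then show "eventually (\<lambda>p. positive_matrix (matrix_inv (fst p) ** A ** fst p ** matrix_inv F)) ?N"
      by (rule eventually_positive_matrix) (rule F)
    have "((\<lambda>p. F ** matrix_inv (fst p) ** snd p) \<longlongrightarrow> F ** matrix_inv X ** X) ?N"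
      by (intro tendsto_matrix_mult tendsto_matrix_inv tendsto_const fst snd X)
    then show "eventually (\<lambda>p. positive_matrix (F ** matrix_inv (fst p) ** snd p)) ?N"
      by (rule eventually_positive_matrix) (simp add: matrix_mult_cancel X F)
    have "((\<lambda>p. matrix_inv (snd p) ** A ** fst p ** matrix_inv F) \<longlongrightarrow> matrix_inv X ** A ** X ** matrix_inv F) ?N"
      by (intro tendsto_matrix_mult tendsto_matrix_inv tendsto_const fst snd X)
    then show "eventually (\<lambda>p. positive_matrix (matrix_inv (snd p) ** A ** fst p ** matrix_inv F)) ?N"
      by (rule eventually_positive_matrix) (rule F)
  qed
  then obtain Q where Q: "eventually Q (nhds X)" "\<And>Y Z. Q Y \<Longrightarrow> Q Z \<Longrightarrow> P (Y, Z)"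
    unfolding eventually_prod_same by blast
  obtain N where N: "open N" "X \<in> N" "\<forall>Y\<in>N. Q Y"
    using Q(1) unfolding eventually_nhds by blast
  show thesis
  proof (rule that[OF N(1,2)])
    fix c d :: real and V W
    assume c: "c > 0" and d: "d > 0" and V: "V \<in> GL U" and W: "W \<in> GL U"
      and "c *\<^sub>R V \<in> N" "d *\<^sub>R W \<in> N"
    then have "P (c *\<^sub>R V, d *\<^sub>R W)" using N Q(2) by blast
    moreover have dV: "det V \<noteq> 0" and dW: "det W \<noteq> 0" using V W GL_det_nz by blast+
    ultimately have pos: "positive_matrix (matrix_inv V ** A ** V ** matrix_inv F)"
      "positive_matrix (F ** matrix_inv V ** W)" "positive_matrix (matrix_inv W ** A ** V ** matrix_inv F)"
      using c d positive_matrix_scaleR[of "d/c"] positive_matrix_scaleR[of "c/d"]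
      by (auto simp: P_def matrix_inv_scaleR matrix_mult_scaleR_left matrix_mult_scaleR_right)
    have over: "matrix_over U V" "matrix_over U W" "matrix_over U F" "matrix_over U (matrix_inv V)"
      "matrix_over U (matrix_inv W)" "matrix_over U (matrix_inv F)"
      using V W F by (auto simp: GL_iff)
    let ?M = "F ** (matrix_inv V ** A ** V ** matrix_inv F)"
    have "pos_ESSE (nonneg_part U) ((matrix_inv V ** A ** V ** matrix_inv F) ** F) ?M"
      using pos F by (intro pos_ESSE_positive_factors matrix_over_mult U over A)
    moreover have "(matrix_inv V ** A ** V ** matrix_inv F) ** F = matrix_inv V ** A ** V"
      by (rule matrix_mult_cancel(4)[OF dF])
    moreover have "pos_ESSE (nonneg_part U)
        ((F ** matrix_inv V ** W) ** (matrix_inv W ** A ** V ** matrix_inv F))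
        ((matrix_inv W ** A ** V ** matrix_inv F) ** (F ** matrix_inv V ** W))"
      using pos by (intro pos_ESSE_positive_factors matrix_over_mult U over A)
    moreover have "(F ** matrix_inv V ** W) ** (matrix_inv W ** A ** V ** matrix_inv F) = ?M"
      by (simp add: matrix_mul_assoc matrix_mult_cancel dW)
    moreover have "(matrix_inv W ** A ** V ** matrix_inv F) ** (F ** matrix_inv V ** W) = matrix_inv W ** A ** W"
      by (simp add: matrix_mul_assoc matrix_mult_cancel dF dV)
    ultimately show "(pos_ESSE (nonneg_part U))\<^sup>+\<^sup>+ (matrix_inv V ** A ** V) (matrix_inv W ** A ** W)"
      by (metis tranclp.simps)
  qed
qed

text \<open>The preceding lemma links the conjugates of \<open>A\<close> by elements of \<open>scaled_GL U\<close> near each point of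
  \<open>C\<close>.  The points of \<open>C\<close> themselves give conjugates that need not be over \<open>U\<close>, so the
  equivalence relation carried along \<open>C\<close> compares neighbourhoods of points.  It is transitive because
  two neighbourhoods of one point share an element of the dense set \<open>scaled_GL U\<close>.\<close>

lemma conjugates_in_connected_set:
  fixes A :: "real^'n^'n"
  assumes U: "subring_of_reals U" "unital_nondiscrete U" and A: "matrix_over U A"
    and C: "connected C" "\<And>X. X \<in> C \<Longrightarrow> det X \<noteq> 0 \<and> positive_matrix (matrix_inv X ** A ** X)"
    and V: "V \<in> C" "V \<in> GL U" and W: "W \<in> C" "W \<in> GL U"
  shows "(pos_ESSE (nonneg_part U))\<^sup>+\<^sup>+ (matrix_inv V ** A ** V) (matrix_inv W ** A ** W)"
proof -
  define linked where "linked N M \<longleftrightarrow>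
    (\<forall>c V d W. c > 0 \<longrightarrow> d > 0 \<longrightarrow> V \<in> GL U \<longrightarrow> W \<in> GL U \<longrightarrow> c *\<^sub>R V \<in> N \<longrightarrow> d *\<^sub>R W \<in> M \<longrightarrow>
       (pos_ESSE (nonneg_part U))\<^sup>+\<^sup>+ (matrix_inv V ** A ** V) (matrix_inv W ** A ** W))"
    for N M :: "(real^'n^'n) set"
  have linked_sym: "linked M N" if "linked N M" for N M
    using that tranclp_pos_ESSE_sym unfolding linked_def by blast
  define R where "R X Y \<longleftrightarrow> (\<exists>N M. open N \<and> open M \<and> X \<in> N \<and> Y \<in> M \<and> linked N M)" for X Y
  have "R V W"
  proof (rule connected_equivalence_relation[OF C(1) V(1) W(1)])
    show "R Y X" if "R X Y" for X Y
      using that linked_sym unfolding R_def by blast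
    show "R X Z" if XY: "R X Y" and YZ: "R Y Z" and Y: "Y \<in> C" for X Y Z
    proof -
      obtain N M where NM: "open N" "open M" "X \<in> N" "Y \<in> M" "linked N M"
        using XY unfolding R_def by blast
      obtain M' K where MK: "open M'" "open K" "Y \<in> M'" "Z \<in> K" "linked M' K"
        using YZ unfolding R_def by blast
      have "Y \<in> closure (scaled_GL U)"
        using C(2)[OF Y] invertible_in_closure_scaled_GL[OF U] by blast
      then have "scaled_GL U \<inter> (M \<inter> M') \<noteq> {}"
        using NM MK open_Int_closure_eq_empty[of "M \<inter> M'" "scaled_GL U"] by blast
      then obtain e E where E: "e > 0" "E \<in> GL U" "e *\<^sub>R E \<in> M" "e *\<^sub>R E \<in> M'"
        unfolding scaled_GL_def by blast
      have "linked N K"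
        using NM(5) MK(5) E unfolding linked_def by (meson tranclp_trans)
      then show ?thesis using NM MK unfolding R_def by blast
    qed
    show "\<exists>T. openin (top_of_set C) T \<and> X \<in> T \<and> (\<forall>Y\<in>T. R X Y)" if X: "X \<in> C" for X
    proof -
      obtain N where N: "open N" "X \<in> N" "linked N N"
        using conjugates_nearby[OF U A, of X] C(2)[OF X] unfolding linked_def by metis
      have "R X Y" if "Y \<in> N" for Y
        using N that unfolding R_def by blast
      then show ?thesis
        using N X by (intro exI[of _ "C \<inter> N"]) (auto simp: openin_open_Int)
    qed
  qed
  then obtain N M where "V \<in> N" "W \<in> M" "linked N M" unfolding R_def by blast
  then show ?thesis
    using V(2) W(2) unfolding linked_def by (metis scaleR_one zero_less_one)
qed

section \<open>Lifting a family of conjugate matrices to conjugators\<close>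

text \<open>A matrix \<open>X\<close> conjugates \<open>At s\<close> to \<open>At t\<close> exactly if it is invertible and lies in the kernel of
  \<open>L t : X \<mapsto> At s X - X At t\<close>.  Conjugacy makes the rank of \<open>L t\<close> constant, so the kernel
  varies continuously: a complement \<open>N\<close> of the kernel of \<open>L s\<close> is still mapped isomorphically onto
  the range of \<open>L t\<close> for \<open>t\<close> near \<open>s\<close>, and \<open>W t\<close> is the identity corrected by the unique element of
  \<open>N\<close> with the same image under \<open>L t\<close>.\<close>

lemma continuous_local_conjugators:
  fixes At :: "'a::metric_space \<Rightarrow> real^'n^'n"
  assumes cont: "continuous_on S At" and s: "s \<in> S"
    and conj: "\<And>t. t \<in> S \<Longrightarrow> \<exists>G. det G \<noteq> 0 \<and> At s ** G = G ** At t"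
  obtains e W where "e > 0" "continuous_on (S \<inter> ball s e) W" "W s = mat 1"
    "\<And>t. t \<in> S \<inter> ball s e \<Longrightarrow> det (W t) \<noteq> 0 \<and> At s ** W t = W t ** At t"
proof -
  define L where "L t X = At s ** X - X ** At t" for t X
  have linL: "linear (L t)" for t
    unfolding L_def
    by (intro linearI) (simp_all add: matrix_add_ldistrib matrix_mult_add_left
      matrix_mult_scaleR_left matrix_mult_scaleR_right scaleR_diff_right add_diff_add)
  have L_diff: "L t X - L u X = X ** (At u - At t)" for t u X
    by (simp add: L_def matrix_mult_diff_right)
  have "\<exists>k>0. \<forall>(A :: real^'n^'n) B :: real^'n^'n. norm (A ** B) \<le> norm A * norm B * k"
    by (rule bounded_bilinear.pos_bounded[OF bounded_bilinear_matrix_mult])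
  then obtain k where k: "k > 0" "\<And>(A :: real^'n^'n) B :: real^'n^'n. norm (A ** B) \<le> norm A * norm B * k"
    by metis
  define N where "N = orthogonal_comp {X. L s X = 0}"
  have K: "subspace {X. L s X = 0}"
    using linear_subspace_kernel[OF linL] .
  have N: "subspace N" unfolding N_def by (rule subspace_orthogonal_comp)
  have "\<forall>X\<in>N. L s X = 0 \<longrightarrow> X = 0"
    unfolding N_def orthogonal_comp_def by (auto simp: orthogonal_self)
  then obtain c where c: "c > 0" "\<And>X. X \<in> N \<Longrightarrow> norm (L s X) \<ge> c * norm X"
    using injective_imp_isometric[OF closed_subspace[OF N] N, of "L s"] linL linear_conv_bounded_linear
    by blast
  define D where "D = {t \<in> S. norm (At s - At t) * k \<le> c / 2}"
  have sD: "s \<in> D" using s c by (simp add: D_def)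
  have lower: "norm (L t X) \<ge> c / 2 * norm X" if "t \<in> D" "X \<in> N" for t X
  proof -
    have "norm (L t X - L s X) \<le> norm X * (norm (At s - At t) * k)"
      using k(2)[of X "At s - At t"] by (simp add: L_diff mult_ac)
    also have "\<dots> \<le> norm X * (c / 2)"
      using that by (intro mult_left_mono) (auto simp: D_def)
    finally show ?thesis
      using c(2)[OF that(2)] norm_triangle_ineq4[of "L t X" "L t X - L s X"] by (simp add: field_simps)
  qed
  \<comment> \<open>injectivity gives \<open>dim (L t ` N) = dim N\<close>, and conjugacy bounds the rank of \<open>L t\<close> by that of \<open>L s\<close>\<close>
  have range: "range (L t) = L t ` N" if t: "t \<in> D" for t
  proof -
    obtain G where G: "det G \<noteq> 0" "At s ** G = G ** At t"
      using conj t unfolding D_def by blast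
    have LG: "L t (X ** G) = L s X ** G" for X
      by (simp add: L_def matrix_mult_diff_left matrix_mul_assoc)
         (simp add: G flip: matrix_mul_assoc)
    have "L t X \<in> (\<lambda>Z. Z ** G) ` range (L s)" for X
      using LG[of "X ** matrix_inv G"] by (auto simp: matrix_mult_cancel G)
    then have "dim (range (L t)) \<le> dim ((\<lambda>Z. Z ** G) ` range (L s))"
      by (intro dim_subset) auto
    also have "\<dots> \<le> dim (range (L s))"
      by (intro dim_image_le linearI) (simp_all add: matrix_mult_add_left matrix_mult_scaleR_left)
    also have "range (L s) = L s ` N"
    proof -
      have "L s X \<in> L s ` N" for X
      proof -
        obtain y z where yz: "y \<in> span {X. L s X = 0}"
            "\<And>w. w \<in> span {X. L s X = 0} \<Longrightarrow> orthogonal z w" "X = y + z"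
          using orthogonal_subspace_decomp_exists[of "{X. L s X = 0}" X] by metis
        have "L s X = L s z"
          using yz(1) linear_add[OF linL] K by (simp add: yz(3) span_eq_iff[THEN iffD2, OF K])
        moreover have "z \<in> N"
          using yz(2)[OF span_base] unfolding N_def orthogonal_comp_def
          by (auto simp: orthogonal_commute)
        ultimately show ?thesis by blast
      qed
      then show ?thesis by auto
    qed
    also have "dim (L s ` N) \<le> dim N" by (rule dim_image_le[OF linL])
    also have "\<dots> = dim (L t ` N)"
    proof (rule dim_image_eq[OF linL, symmetric])
      show "inj_on (L t) (span N)"
        unfolding span_eq_iff[THEN iffD2, OF N]
      proof (rule inj_onI)
        fix X Y assume "X \<in> N" "Y \<in> N" "L t X = L t Y"
        then have "L t (X - Y) = 0" "X - Y \<in> N"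
          using linear_diff[OF linL] subspace_diff[OF N] by auto
        then show "X = Y" using lower[OF t, of "X - Y"] c by (simp add: mult_le_0_iff)
      qed
    qed
    finally show ?thesis
      using subspace_dim_equal[of "L t ` N" "range (L t)"] N linL
      by (simp add: linear_subspace_image image_mono)
  qed
  then have "\<exists>Y\<in>N. L t Y = L t (mat 1)" if "t \<in> D" for t
    using that by (metis imageE rangeI)
  then obtain Y where Y: "\<And>t. t \<in> D \<Longrightarrow> Y t \<in> N" "\<And>t. t \<in> D \<Longrightarrow> L t (Y t) = L t (mat 1)"
    by metis
  define W where "W t = mat 1 - Y t" for t
  have LW: "L t (W t) = 0" if "t \<in> D" for t
    using Y(2)[OF that] linear_diff[OF linL] by (simp add: W_def)
  have W_s: "W s = mat 1"
  proof -
    have "L s (Y s) = 0" using Y(2)[OF sD] by (simp add: L_def)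
    then show ?thesis using lower[OF sD Y(1)[OF sD]] c by (simp add: W_def mult_le_0_iff)
  qed
  have cont_W: "continuous_on D W"
  proof -
    have "(W \<longlongrightarrow> W u) (at u within D)" if u: "u \<in> D" for u
    proof (rule LIM_zero_cancel, rule Lim_null_comparison)
      have "norm (W t - W u) \<le> 2 / c * (norm (W u) * norm (At u - At t) * k)" if t: "t \<in> D" for t
      proof -
        have "W u - W t \<in> N"
          using subspace_diff[OF N Y(1)[OF t] Y(1)[OF u]] by (simp add: W_def)
        then have "c / 2 * norm (W u - W t) \<le> norm (L t (W u - W t))"
          using lower[OF t] by blast
        also have "L t (W u - W t) = L t (W u) - L u (W u)"
          using linear_diff[OF linL] LW t u by simp
        also have "norm \<dots> \<le> norm (W u) * norm (At u - At t) * k"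
          unfolding L_diff by (rule k)
        finally show ?thesis using c by (simp add: norm_minus_commute field_simps)
      qed
      then show "\<forall>\<^sub>F t in at u within D. norm (W t - W u) \<le> 2 / c * (norm (W u) * norm (At u - At t) * k)"
        by (auto simp: eventually_at_filter)
      have "continuous_on D At" using cont by (rule continuous_on_subset) (auto simp: D_def)
      then have "(At \<longlongrightarrow> At u) (at u within D)" using u by (simp add: continuous_on_def)
      then have "((\<lambda>t. 2 / c * (norm (W u) * norm (At u - At t) * k)) \<longlongrightarrow>
          2 / c * (norm (W u) * norm (At u - At u) * k)) (at u within D)"
        by (intro tendsto_intros)
      then show "((\<lambda>t. 2 / c * (norm (W u) * norm (At u - At t) * k)) \<longlongrightarrow> 0) (at u within D)" by simp
    qed
    then show ?thesis by (simp add: continuous_on_def)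
  qed
  have "((\<lambda>t. det (W t)) \<longlongrightarrow> det (W s)) (at s within D)"
    using cont_W sD by (intro tendsto_det) (simp add: continuous_on_def)
  from tendsto_imp_eventually_ne[OF this, of 0] W_s
  have "eventually (\<lambda>t. det (W t) \<noteq> 0) (at s within D)" by simp
  then obtain e1 where e1: "e1 > 0" "\<And>t. t \<in> D \<Longrightarrow> dist t s < e1 \<Longrightarrow> det (W t) \<noteq> 0"
    unfolding eventually_at using W_s by (metis det_I one_neq_zero)
  have "((\<lambda>t. norm (At s - At t) * k) \<longlongrightarrow> norm (At s - At s) * k) (at s within S)"
    using cont s by (intro tendsto_intros) (simp add: continuous_on_def)
  then have "eventually (\<lambda>t. norm (At s - At t) * k < c / 2) (at s within S)"
    using c by (intro order_tendstoD) auto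
  then obtain e2 where e2: "e2 > 0" "\<And>t. t \<in> S \<Longrightarrow> dist t s < e2 \<Longrightarrow> t \<in> D"
    unfolding eventually_at D_def using sD D_def by (metis (no_types, lifting) less_imp_le mem_Collect_eq)
  show thesis
  proof (rule that[of "min e1 e2" W])
    have D: "S \<inter> ball s (min e1 e2) \<subseteq> D" using e2 by (auto simp: dist_commute)
    then show "continuous_on (S \<inter> ball s (min e1 e2)) W"
      using cont_W continuous_on_subset by blast
    show "det (W t) \<noteq> 0 \<and> At s ** W t = W t ** At t" if "t \<in> S \<inter> ball s (min e1 e2)" for t
      using that D e1(2)[of t] LW[of t] by (auto simp: L_def dist_commute)
  qed (use e1 e2 W_s in auto)
qed

text \<open>Local sections are chained into a connected set: a connected set of conjugators that starts at the
  identity is translated by the conjugator reached so far.\<close>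

lemma connected_set_of_conjugators:
  fixes At :: "'a::real_normed_vector \<Rightarrow> real^'n^'n"
  assumes cont: "continuous_on S At" and S: "convex S" "a \<in> S" "b \<in> S"
    and conj: "\<And>s t. s \<in> S \<Longrightarrow> t \<in> S \<Longrightarrow> \<exists>G. det G \<noteq> 0 \<and> At s ** G = G ** At t"
  obtains C Y where "connected C" "mat 1 \<in> C" "Y \<in> C" "At a ** Y = Y ** At b"
    "\<And>Z. Z \<in> C \<Longrightarrow> det Z \<noteq> 0 \<and> (\<exists>t\<in>S. At a ** Z = Z ** At t)"
proof -
  define R where "R s t \<longleftrightarrow> (\<exists>C Y. connected C \<and> mat 1 \<in> C \<and> Y \<in> C \<and> At s ** Y = Y ** At t \<and>
      (\<forall>Z\<in>C. det Z \<noteq> 0 \<and> (\<exists>u\<in>S. At s ** Z = Z ** At u)))" for s t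
  have translate: "connected ((**) X ` C)" if "connected C" for X :: "real^'n^'n" and C :: "(real^'n^'n) set"
    using that
    by (intro connected_continuous_image linear_continuous_on
        bounded_bilinear.bounded_linear_right[OF bounded_bilinear_matrix_mult])
  have "R a b"
  proof (rule connected_equivalence_relation[OF convex_connected[OF S(1)] S(2,3)])
    show "R t s" if st: "R s t" for s t
    proof -
      obtain C Y where C: "connected C" "mat 1 \<in> C" "Y \<in> C" "At s ** Y = Y ** At t"
          "\<And>Z. Z \<in> C \<Longrightarrow> det Z \<noteq> 0 \<and> (\<exists>u\<in>S. At s ** Z = Z ** At u)"
        using st unfolding R_def by blast
      have Y: "det Y \<noteq> 0" using C by blast
      have inv: "At t ** matrix_inv Y = matrix_inv Y ** At s"
        by (metis C(4) Y matrix_mul_assoc matrix_mult_cancel(2,3))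
      have "det (matrix_inv Y ** Z) \<noteq> 0 \<and> (\<exists>u\<in>S. At t ** (matrix_inv Y ** Z) = (matrix_inv Y ** Z) ** At u)"
        if "Z \<in> C" for Z
        using C(5)[OF that] det_matrix_inv_nz[OF Y] inv by (metis det_mul matrix_mul_assoc mult_eq_0_iff)
      moreover have "mat 1 \<in> (**) (matrix_inv Y) ` C"
        using C(3) matrix_inv_works(2)[OF Y] by (metis imageI)
      moreover have "matrix_inv Y \<in> (**) (matrix_inv Y) ` C"
        using C(2) by (metis imageI matrix_mul_rid)
      ultimately show ?thesis
        unfolding R_def using translate[OF C(1)] inv
        by (intro exI[of _ "(**) (matrix_inv Y) ` C"] exI[of _ "matrix_inv Y"]) auto
    qed
    show "R s r" if st: "R s t" and tr: "R t r" for s t r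
    proof -
      obtain C Y where C: "connected C" "mat 1 \<in> C" "Y \<in> C" "At s ** Y = Y ** At t"
          "\<And>Z. Z \<in> C \<Longrightarrow> det Z \<noteq> 0 \<and> (\<exists>u\<in>S. At s ** Z = Z ** At u)"
        using st unfolding R_def by blast
      obtain C' Y' where C': "connected C'" "mat 1 \<in> C'" "Y' \<in> C'" "At t ** Y' = Y' ** At r"
          "\<And>Z. Z \<in> C' \<Longrightarrow> det Z \<noteq> 0 \<and> (\<exists>u\<in>S. At t ** Z = Z ** At u)"
        using tr unfolding R_def by blast
      have Y: "det Y \<noteq> 0" using C by blast
      have shift: "At s ** (Y ** Z) = (Y ** Z) ** At u" if "At t ** Z = Z ** At u" for Z u
        using that C(4) by (metis matrix_mul_assoc)
      have "Y \<in> (**) Y ` C'" using C'(2) by (metis imageI matrix_mul_rid)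
      then have "connected (C \<union> (**) Y ` C')"
        using C(1,3) translate[OF C'(1)] by (intro connected_Un) auto
      moreover have "det Z \<noteq> 0 \<and> (\<exists>u\<in>S. At s ** Z = Z ** At u)" if "Z \<in> C \<union> (**) Y ` C'" for Z
        using that
      proof
        assume "Z \<in> (**) Y ` C'"
        then obtain Z' where "Z' \<in> C'" "Z = Y ** Z'" by blast
        then show ?thesis using C'(5)[of Z'] shift Y by (auto simp: det_mul)
      qed (use C(5) in blast)
      ultimately show ?thesis
        unfolding R_def using C(2) C'(3) shift[OF C'(4)]
        by (intro exI[of _ "C \<union> (**) Y ` C'"] exI[of _ "Y ** Y'"]) auto
    qed
    show "\<exists>T. openin (top_of_set S) T \<and> s \<in> T \<and> (\<forall>t\<in>T. R s t)" if s: "s \<in> S" for s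
    proof -
      obtain e W where W: "e > 0" "continuous_on (S \<inter> ball s e) W" "W s = mat 1"
          "\<And>t. t \<in> S \<inter> ball s e \<Longrightarrow> det (W t) \<noteq> 0 \<and> At s ** W t = W t ** At t"
        using continuous_local_conjugators[OF cont s] conj s by metis
      have "connected (W ` (S \<inter> ball s e))"
        using W(2) S(1) by (intro connected_continuous_image convex_connected convex_Int) auto
      moreover have "mat 1 \<in> W ` (S \<inter> ball s e)"
        using W(1,3) s by (metis IntI centre_in_ball imageI)
      ultimately have "R s t" if "t \<in> S \<inter> ball s e" for t
        unfolding R_def using W(4) that
        by (intro exI[of _ "W ` (S \<inter> ball s e)"] exI[of _ "W t"]) auto
      then show ?thesis
        using s W(1) by (intro exI[of _ "S \<inter> ball s e"]) (auto simp: openin_open_Int)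
    qed
  qed
  then show thesis using that unfolding R_def by metis
qed

section \<open>Points of the centralizer over a subring\<close>

text \<open>Induction on the number of equations.  When an equation
  \<open>f\<close> is added and some old solution \<open>v\<close> over \<open>U\<close> violates it, the map
  \<open>z \<mapsto> f v z - f z v\<close> sends old solutions to new ones without leaving \<open>U\<close>, and on the new
  solutions it is multiplication by the nonzero number \<open>f v\<close>.\<close>

lemma common_kernel_subset_span:
  fixes F :: "(real^'n^'n \<Rightarrow> real) set"
  assumes U: "subring_of_reals U" "1 \<in> U" and "finite F"
    and "\<And>f. f \<in> F \<Longrightarrow> linear f" "\<And>f X. f \<in> F \<Longrightarrow> matrix_over U X \<Longrightarrow> f X \<in> U"
  shows "{X. \<forall>f\<in>F. f X = 0} \<subseteq> span {X. matrix_over U X \<and> (\<forall>f\<in>F. f X = 0)}"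
  using assms(3-)
proof (induction F rule: finite_induct)
  case empty
  have "(Basis :: (real^'n^'n) set) \<subseteq> {X. matrix_over U X}"
    using U by (auto simp: Basis_vec_def matrix_over_def axis_def subring_of_reals_def)
  then have "span (Basis :: (real^'n^'n) set) \<subseteq> span {X. matrix_over U X}" by (rule span_mono)
  then show ?case by simp
next
  case (insert f F)
  define B where "B F = {X. matrix_over U X \<and> (\<forall>f\<in>F. f X = 0)}" for F :: "(real^'n^'n \<Rightarrow> real) set"
  have IH: "x \<in> span (B F)" if "\<forall>g\<in>F. g x = 0" for x
    using insert that unfolding B_def by blast
  have lin: "linear g" if "g \<in> insert f F" for g using insert.prems that by blast
  show ?case
  proof (cases "\<forall>v\<in>B F. f v = 0")
    case True
    then have "B (insert f F) = B F" by (auto simp: B_def)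
    then show ?thesis using IH unfolding B_def by auto
  next
    case False
    then obtain v where v: "v \<in> B F" "f v \<noteq> 0" by blast
    define \<phi> where "\<phi> z = f v *\<^sub>R z - f z *\<^sub>R v" for z
    have "f (x + y) = f x + f y" "f (c *\<^sub>R x) = c * f x" for x y c
      using linear_add[OF lin] linear_scale[OF lin, of f] by auto
    then have lin_\<phi>: "linear \<phi>"
      unfolding \<phi>_def by (intro linearI) (simp_all add: algebra_simps)
    have "\<phi> z \<in> B (insert f F)" if z: "z \<in> B F" for z
    proof -
      have "f v \<in> U" "f z \<in> U"
        using v z insert.prems(2) by (auto simp: B_def)
      then have "matrix_over U (\<phi> z)"
        using v z U by (auto simp: B_def \<phi>_def matrix_over_def subring_of_reals_def)
      moreover have "g (\<phi> z) = 0" if g: "g \<in> insert f F" for g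
        using v z g linear_diff[OF lin[OF g]] linear_scale[OF lin[OF g]]
        by (auto simp: B_def \<phi>_def)
      ultimately show ?thesis by (simp add: B_def)
    qed
    then have sub: "span (\<phi> ` B F) \<subseteq> span (B (insert f F))"
      by (intro span_mono) auto
    have "x \<in> span (B (insert f F))" if x: "\<forall>g\<in>insert f F. g x = 0" for x
    proof -
      have "\<phi> x \<in> \<phi> ` span (B F)" using IH x by blast
      then have "\<phi> x \<in> span (B (insert f F))"
        using linear_span_image[OF lin_\<phi>] sub by blast
      then have "(1 / f v) *\<^sub>R \<phi> x \<in> span (B (insert f F))" by (rule span_scale)
      then show ?thesis using x v(2) by (simp add: \<phi>_def)
    qed
    then show ?thesis unfolding B_def by blast
  qed
qed

lemma commutant_subset_span:
  fixes A :: "real^'n^'n"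
  assumes U: "subring_of_reals U" "1 \<in> U" and A: "matrix_over U A" and X: "A ** X = X ** A"
  shows "X \<in> span {X. matrix_over U X \<and> A ** X = X ** A}"
proof -
  define f where "f = (\<lambda>(i, j) X. (A ** X - X ** A) $ i $ j)"
  have iff: "(\<forall>g\<in>range f. g X = 0) \<longleftrightarrow> A ** X = X ** A" for X
    by (auto simp: f_def vec_eq_iff)
  have "linear (f p)" for p
    unfolding f_def case_prod_unfold
    by (intro linearI) (simp_all add: matrix_add_ldistrib matrix_mult_add_left
      matrix_mult_scaleR_left matrix_mult_scaleR_right algebra_simps)
  moreover have "f p X \<in> U" if "matrix_over U X" for p X
    using matrix_over_mult[OF U(1) A that] matrix_over_mult[OF U(1) that A] U(1)
    by (auto simp: f_def case_prod_unfold matrix_over_def subring_of_reals_def)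
  ultimately have "{X. \<forall>g\<in>range f. g X = 0} \<subseteq> span {X. matrix_over U X \<and> (\<forall>g\<in>range f. g X = 0)}"
    by (intro common_kernel_subset_span U) auto
  then show ?thesis using X unfolding iff by blast
qed

text \<open>A spanning set over \<open>U\<close> with coefficients from the dense ideal \<open>J\<close> yields a dense subgroup of
  the commutant.\<close>

lemma commutant_dense_points:
  fixes A :: "real^'n^'n"
  assumes U: "subring_of_reals U" "1 \<in> U" and A: "matrix_over U A" and X: "A ** X = X ** A"
    and J: "is_ideal_of J U" "closure J = UNIV"
  shows "X \<in> closure {Y. matrix_over J Y \<and> A ** Y = Y ** A}"
proof -
  let ?M = "{Y. matrix_over J Y \<and> A ** Y = Y ** A}"
  have J_add: "x + y \<in> J" if "x \<in> J" "y \<in> J" for x y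
  proof -
    have "x - (0 - y) \<in> J" using J(1) that unfolding is_ideal_of_def by blast
    then show ?thesis by simp
  qed
  have M_add: "Y + Z \<in> ?M" if "Y \<in> ?M" "Z \<in> ?M" for Y Z
    using that by (auto simp: matrix_over_def matrix_add_ldistrib matrix_mult_add_left intro: J_add)
  have scale: "r *\<^sub>R B \<in> closure ?M" if B: "matrix_over U B" "A ** B = B ** A" for r B
  proof -
    have "r \<in> closure J" using J by simp
    then obtain u where u: "\<And>k. u k \<in> J" "u \<longlonglongrightarrow> r" unfolding closure_sequential by blast
    have "u k *\<^sub>R B \<in> ?M" for k
      using u(1)[of k] B J(1)
      by (auto simp: matrix_over_def is_ideal_of_def matrix_mult_scaleR_left matrix_mult_scaleR_right mult.commute[of "u k"])
    moreover have "(\<lambda>k. u k *\<^sub>R B) \<longlonglongrightarrow> r *\<^sub>R B" by (intro tendsto_intros u)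
    ultimately show ?thesis unfolding closure_sequential by (intro exI[of _ "\<lambda>k. u k *\<^sub>R B"]) blast
  qed
  have add: "Y + Z \<in> closure ?M" if YZ: "Y \<in> closure ?M" "Z \<in> closure ?M" for Y Z
  proof -
    obtain f where f: "\<And>k. f k \<in> ?M" "f \<longlonglongrightarrow> Y" using YZ(1) unfolding closure_sequential by blast
    obtain g where g: "\<And>k. g k \<in> ?M" "g \<longlonglongrightarrow> Z" using YZ(2) unfolding closure_sequential by blast
    show ?thesis
      unfolding closure_sequential using M_add[OF f(1) g(1)] tendsto_add[OF f(2) g(2)]
      by (intro exI[of _ "\<lambda>k. f k + g k"]) blast
  qed
  show ?thesis
    using commutant_subset_span[OF U A X]
  proof (induction rule: span_induct_alt)
    case base
    have "0 *\<^sub>R mat 1 \<in> closure ?M" by (rule scale) (auto simp: matrix_over_mat_1 U)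
    then show ?case by simp
  next
    case (step c x y)
    then show ?case using scale add by blast
  qed
qed

lemma GL_if_unit_det:
  fixes X :: "real^'n^'n"
  assumes U: "subring_of_reals U" "1 \<in> U" and X: "matrix_over U X" and unit: "is_unit_in U (det X)"
  shows "X \<in> GL U"
proof -
  obtain y where y: "y \<in> U" "det X * y = 1" using unit unfolding is_unit_in_def by blast
  then have d: "det X \<noteq> 0" by auto
  have "matrix_inv X $ k $ j \<in> U" for k j
  proof -
    let ?C = "\<chi> i l. if l = k then (if i = j then 1 else 0) else X $ i $ l"
    have "matrix_over U ?C"
      using X U by (auto simp: matrix_over_def subring_of_reals_def)
    then have "det ?C \<in> U" using det_in_subring[OF U] by blast
    moreover have "matrix_inv X $ k $ j = det ?C * y"
      using y d by (simp add: matrix_inv_cramer[OF d] field_simps)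
    ultimately show ?thesis using subring_mult[OF U(1)] y by simp
  qed
  then show ?thesis using X d by (simp add: GL_iff matrix_over_def)
qed

lemma det_congruent_1:
  fixes M :: "real^'n^'n"
  assumes U: "subring_of_reals U" "1 \<in> U" and J: "is_ideal_of J U" and M: "matrix_over J M"
  shows "det (mat 1 + M) - 1 \<in> J"
proof -
  let ?X = "mat 1 + M"
  have JU: "x \<in> U" if "x \<in> J" for x using J that unfolding is_ideal_of_def by blast
  have J_mult: "u * x \<in> J" if "u \<in> U" "x \<in> J" for u x
    using J that unfolding is_ideal_of_def by blast
  have J0: "0 \<in> J" using J unfolding is_ideal_of_def by blast
  have J_add: "x + y \<in> J" if "x \<in> J" "y \<in> J" for x y
  proof -
    have "x - (0 - y) \<in> J" using J that unfolding is_ideal_of_def by blast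
    then show ?thesis by simp
  qed
  have J_sum: "sum f I \<in> J" if "\<And>i. i \<in> I \<Longrightarrow> f i \<in> J" for f :: "('n \<Rightarrow> 'n) \<Rightarrow> real" and I
    using that by (induction I rule: infinite_finite_induct) (auto intro: J0 J_add)
  have XU: "?X $ i $ j \<in> U" for i j
    using M U JU subring_add[OF U(1)] by (auto simp: mat_def matrix_over_def subring_of_reals_def)
  have off: "of_int (sign p) * (\<Prod>i\<in>UNIV. ?X $ i $ p i) \<in> J" if p: "p \<noteq> id" for p
  proof -
    obtain i where i: "p i \<noteq> i" using p by (auto simp: fun_eq_iff)
    then have "?X $ i $ p i \<in> J" using M by (simp add: mat_def matrix_over_def)
    moreover have "(\<Prod>i\<in>UNIV - {i}. ?X $ i $ p i) \<in> U"
      by (rule subring_prod[OF U XU])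
    ultimately have "(\<Prod>i\<in>UNIV - {i}. ?X $ i $ p i) * ?X $ i $ p i \<in> J"
      by (rule J_mult[rotated])
    then have "(\<Prod>i\<in>UNIV. ?X $ i $ p i) \<in> J"
      by (subst prod.remove[of UNIV i]) (simp_all add: mult.commute)
    moreover have "of_int (sign p) \<in> U" using U by (auto simp: sign_def subring_minus)
    ultimately show ?thesis by (rule J_mult[rotated])
  qed
  have diag: "(\<Prod>i\<in>I. ?X $ i $ i) - 1 \<in> J" if "finite I" for I
    using that
  proof (induction I rule: finite_induct)
    case empty
    then show ?case using J0 by simp
  next
    case (insert i I)
    have "(\<Prod>i\<in>insert i I. ?X $ i $ i) - 1 = ?X $ i $ i * ((\<Prod>i\<in>I. ?X $ i $ i) - 1) + M $ i $ i"
      using insert.hyps by (simp add: mat_def algebra_simps)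
    also have "\<dots> \<in> J"
      using M by (intro J_add J_mult XU insert.IH) (simp add: matrix_over_def)
    finally show ?case .
  qed
  have "det ?X = (\<Prod>i\<in>UNIV. ?X $ i $ i) +
      (\<Sum>p\<in>{p. p permutes UNIV} - {id}. of_int (sign p) * (\<Prod>i\<in>UNIV. ?X $ i $ p i))"
    unfolding det_def
    by (subst sum.remove[of _ id]) (auto simp: permutes_id finite_permutations)
  moreover have "(\<Sum>p\<in>{p. p permutes UNIV} - {id}. of_int (sign p) * (\<Prod>i\<in>UNIV. ?X $ i $ p i)) \<in> J"
    using off by (intro J_sum) auto
  ultimately have "((\<Prod>i\<in>UNIV. ?X $ i $ i) - 1) + (det ?X - (\<Prod>i\<in>UNIV. ?X $ i $ i)) \<in> J"
    by (intro J_add diag) simp_all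
  then show ?thesis by simp
qed

lemma nonzero_ideal_dense:
  assumes U: "closure U = UNIV" and J: "is_ideal_of J U" and x: "x \<in> J" "x \<noteq> 0"
  shows "closure J = UNIV"
proof -
  have "y \<in> closure J" for y
  proof -
    have "y / x \<in> closure U" using U by simp
    then obtain u where u: "\<And>k. u k \<in> U" "u \<longlonglongrightarrow> y / x" unfolding closure_sequential by blast
    have "u k * x \<in> J" for k using J u(1) x unfolding is_ideal_of_def by blast
    moreover have "(\<lambda>k. u k * x) \<longlonglongrightarrow> y / x * x" by (intro tendsto_intros u)
    ultimately show ?thesis unfolding closure_sequential
      using x by (intro exI[of _ "\<lambda>k. u k * x"]) auto
  qed
  then show ?thesis by blast
qed

text \<open>Components of the centralizer are relatively open in the commutant, so it is enough to find a commuting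
  matrix over \<open>U\<close> close to a given point and with determinant outside \<open>J\<close>.  If \<open>J = 0\<close> every
  commuting matrix over \<open>U\<close> close to the point will do.  Otherwise \<open>J\<close> is dense, and the approximation can be
  taken congruent to the identity modulo \<open>J\<close>, which makes its determinant congruent to \<open>1\<close>.\<close>

lemma centralizer_component_meets_GL:
  fixes A :: "real^'n^'n"
  assumes U: "subring_of_reals U" "unital_nondiscrete U" and A: "matrix_over U A"
    and J: "is_ideal_of J U" "J \<noteq> U" "\<And>x. x \<in> U - J \<Longrightarrow> is_unit_in U x"
    and K: "K \<in> components (Cent A)"
  shows "\<exists>W\<in>GL U. W \<in> K"
proof -
  have one: "1 \<in> U" and dense: "closure U = UNIV" using U(2) by (auto simp: unital_nondiscrete_def)
  obtain Y where Y: "Y \<in> K" using in_components_nonempty[OF K] by blast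
  then have "Y \<in> Cent A" using in_components_subset[OF K] by blast
  then have dY: "det Y \<noteq> 0" and cY: "A ** Y = Y ** A" by (auto simp: Cent_def GL_UNIV_iff)
  have "eventually (\<lambda>X. det X \<noteq> 0) (nhds Y)"
    using tendsto_imp_eventually_ne[OF tendsto_det[OF filterlim_ident] dY] .
  then obtain e where e: "e > 0" "\<And>X. dist X Y < e \<Longrightarrow> det X \<noteq> 0"
    unfolding eventually_nhds_metric by blast
  let ?C = "ball Y e \<inter> {X. A ** X = X ** A}"
  have "convex {X. A ** X = X ** A}"
    by (rule convexI) (simp add: matrix_add_ldistrib matrix_mult_add_left
        matrix_mult_scaleR_left matrix_mult_scaleR_right)
  then have "connected ?C" by (intro convex_connected convex_Int) auto
  moreover have "?C \<subseteq> Cent A" using e(2) by (auto simp: Cent_def GL_UNIV_iff dist_commute)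
  moreover have "K \<inter> ?C \<noteq> {}" using Y cY e(1) by auto
  ultimately have CK: "?C \<subseteq> K" using components_maximal[OF K] by blast
  have "1 \<notin> J"
  proof
    assume "1 \<in> J"
    then have "u * 1 \<in> J" if "u \<in> U" for u using J(1) that unfolding is_ideal_of_def by blast
    then show False using J(1,2) unfolding is_ideal_of_def by auto
  qed
  obtain X where X: "X \<in> ?C" "matrix_over U X" "det X \<notin> J"
  proof (cases "J = {0}")
    case True
    have "is_ideal_of U U"
      using U(1) by (auto simp: is_ideal_of_def subring_of_reals_def)
    then have "Y \<in> closure {Y. matrix_over U Y \<and> A ** Y = Y ** A}"
      by (rule commutant_dense_points[OF U(1) one A cY _ dense])
    then obtain X where "matrix_over U X" "A ** X = X ** A" "dist X Y < e"
      unfolding closure_approachable using e(1) by blast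
    then show thesis using that[of X] e(2)[of X] True by (auto simp: dist_commute)
  next
    case False
    then obtain x where "x \<in> J" "x \<noteq> 0" using J(1) unfolding is_ideal_of_def by blast
    then have "closure J = UNIV" using nonzero_ideal_dense[OF dense J(1)] by blast
    moreover have "A ** (Y - mat 1) = (Y - mat 1) ** A"
      using cY by (simp add: matrix_mult_diff_left matrix_mult_diff_right)
    ultimately have "Y - mat 1 \<in> closure {Y. matrix_over J Y \<and> A ** Y = Y ** A}"
      using commutant_dense_points[OF U(1) one A _ J(1)] by blast
    then obtain M where M: "matrix_over J M" "A ** M = M ** A" "dist M (Y - mat 1) < e"
      unfolding closure_approachable using e(1) by blast
    let ?X = "mat 1 + M"
    have "?X \<in> ?C"
      using M(2,3) by (simp add: matrix_add_ldistrib matrix_mult_add_left dist_norm norm_minus_commute algebra_simps)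
    moreover have "matrix_over U M" using M(1) J(1) unfolding matrix_over_def is_ideal_of_def by blast
    then have "matrix_over U ?X"
      using matrix_over_mat_1[OF U(1) one, where ?'a = 'n] subring_add[OF U(1)] by (auto simp: matrix_over_def)
    moreover have "det ?X \<notin> J"
    proof
      assume "det ?X \<in> J"
      then have "det ?X - (det ?X - 1) \<in> J"
        using det_congruent_1[OF U(1) one J(1) M(1)] J(1) unfolding is_ideal_of_def by blast
      then show False using \<open>1 \<notin> J\<close> by simp
    qed
    ultimately show thesis using that by blast
  qed
  then have "X \<in> GL U"
    using det_in_subring[OF U(1) one] J(3) by (intro GL_if_unit_det U(1) one) auto
  then show ?thesis using X CK by blast
qed

section \<open>The path theorem\<close>

text \<open>The set \<open>C\<close> leads from the identity to \<open>Y\<close>, and the identity component of the centralizer,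
  translated by \<open>Y\<close>, continues from \<open>Y\<close> to \<open>W\<close>; on that second piece the conjugate of \<open>A\<close> is
  constantly \<open>B\<close>.\<close>

lemma SSE_if_identity_component:
  fixes A B :: "real^'n^'n"
  assumes U: "subring_of_reals U" "unital_nondiscrete U" and A: "matrix_over U A"
    and C: "connected C" "mat 1 \<in> C" "Y \<in> C"
      "\<And>Z. Z \<in> C \<Longrightarrow> det Z \<noteq> 0 \<and> positive_matrix (matrix_inv Z ** A ** Z)"
    and Y: "matrix_inv Y ** A ** Y = B"
    and W: "W \<in> GL U" "matrix_inv W ** A ** W = B"
    and comp: "W ** matrix_inv Y \<in> connected_component_set (Cent A) (mat 1)"
  shows "SSE_through_positive (nonneg_part U) A B"
proof -
  have one: "mat 1 \<in> GL U" using mat_1_in_GL U by (auto simp: unital_nondiscrete_def)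
  have dY: "det Y \<noteq> 0" and posB: "positive_matrix B" using C(3,4) Y by auto
  let ?K = "connected_component_set (Cent A) (mat 1)"
  let ?D = "C \<union> (\<lambda>Z. Z ** Y) ` ?K"
  have "mat 1 \<in> Cent A" by (simp add: Cent_def GL_UNIV_iff)
  then have "mat 1 \<in> ?K" by simp
  then have "mat 1 ** Y \<in> (\<lambda>Z. Z ** Y) ` ?K" by (rule imageI)
  then have "Y \<in> (\<lambda>Z. Z ** Y) ` ?K" by simp
  moreover have "connected ((\<lambda>Z. Z ** Y) ` ?K)"
    by (intro connected_continuous_image linear_continuous_on connected_connected_component
        bounded_bilinear.bounded_linear_left[OF bounded_bilinear_matrix_mult])
  ultimately have "connected ?D"
    using C(1,3) by (intro connected_Un) auto
  moreover have "det X \<noteq> 0 \<and> positive_matrix (matrix_inv X ** A ** X)" if "X \<in> ?D" for X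
    using that
  proof
    assume "X \<in> (\<lambda>Z. Z ** Y) ` ?K"
    then obtain Z where "Z \<in> Cent A" and X: "X = Z ** Y"
      using connected_component_subset by blast
    then have Z: "det Z \<noteq> 0" "A ** Z = Z ** A" by (auto simp: Cent_def GL_UNIV_iff)
    have "A ** X = X ** B"
      using Z(2) Y conjugate_eq_iff[OF dY] X by (metis matrix_mul_assoc)
    moreover have dX: "det X \<noteq> 0" using Z(1) dY X by (simp add: det_mul)
    ultimately show ?thesis using posB conjugate_eq_iff[OF dX] by metis
  qed (use C(4) in blast)
  moreover have "W \<in> ?D"
  proof -
    have "W ** matrix_inv Y ** Y \<in> (\<lambda>Z. Z ** Y) ` ?K" using comp by blast
    then show ?thesis by (simp add: matrix_mult_cancel dY)
  qed
  moreover have "mat 1 \<in> ?D" using C(2) by blast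
  ultimately have "(pos_ESSE (nonneg_part U))\<^sup>+\<^sup>+
      (matrix_inv (mat 1) ** A ** mat 1) (matrix_inv W ** A ** W)"
    using conjugates_in_connected_set[OF U A] one W(1) by blast
  moreover have "matrix_inv (mat 1) = (mat 1 :: real^'n^'n)" by (rule matrix_inv_eqI) simp
  ultimately show ?thesis using W(2) by (simp add: SSE_through_positive_if_tranclp)
qed

text \<open>A conjugator \<open>V\<close> over \<open>U\<close> may lie in the wrong component relative to \<open>Y\<close>.  Multiplying it by an
  element \<open>X\<close> of \<open>GL U\<close> from the component of \<open>Y V\<^sup>-\<^sup>1\<close> in the centralizer moves \<open>X V Y\<^sup>-\<^sup>1\<close> into the
  identity component.\<close>

lemma SSE_if_components_meet_GL:
  fixes A B :: "real^'n^'n"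
  assumes U: "subring_of_reals U" "unital_nondiscrete U" and A: "matrix_over U A"
    and C: "connected C" "mat 1 \<in> C" "Y \<in> C"
      "\<And>Z. Z \<in> C \<Longrightarrow> det Z \<noteq> 0 \<and> positive_matrix (matrix_inv Z ** A ** Z)"
    and Y: "matrix_inv Y ** A ** Y = B"
    and AB: "conjugate_over U A B"
    and comps: "\<And>K. K \<in> components (Cent A) \<Longrightarrow> \<exists>W\<in>GL U. W \<in> K"
  shows "SSE_through_positive (nonneg_part U) A B"
proof -
  obtain V where V: "V \<in> GL U" "matrix_inv V ** A ** V = B"
    using AB unfolding conjugate_over_def by blast
  have dV: "det V \<noteq> 0" and dY: "det Y \<noteq> 0" using V C by (auto simp: GL_det_nz)
  have AV: "A ** V = V ** B" and AY: "A ** Y = Y ** B"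
    using V Y conjugate_eq_iff dV dY by blast+
  define Z where "Z = Y ** matrix_inv V"
  have dZ: "det Z \<noteq> 0" using dY det_matrix_inv_nz[OF dV] by (simp add: Z_def det_mul)
  have BV: "B ** matrix_inv V = matrix_inv V ** A"
    by (metis AV dV matrix_mul_assoc matrix_mult_cancel(2,3))
  have AZ: "A ** Z = Z ** A"
    unfolding Z_def using AY BV by (metis matrix_mul_assoc)
  then have ZC: "Z \<in> Cent A" using dZ by (simp add: Cent_def GL_UNIV_iff)
  let ?K = "connected_component_set (Cent A) Z"
  have "?K \<in> components (Cent A)" using ZC by (rule componentsI)
  then obtain X where X: "X \<in> GL U" "X \<in> ?K" using comps by blast
  have "X \<in> Cent A" using X(2) connected_component_subset by blast
  then have dX: "det X \<noteq> 0" and AX: "A ** X = X ** A" by (auto simp: Cent_def GL_UNIV_iff)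
  have ZA: "A ** matrix_inv Z = matrix_inv Z ** A"
    by (metis AZ dZ matrix_mul_assoc matrix_mult_cancel(2,3))
  let ?L = "(\<lambda>T. T ** matrix_inv Z) ` ?K"
  have "connected ?L"
    by (intro connected_continuous_image linear_continuous_on connected_connected_component
        bounded_bilinear.bounded_linear_left[OF bounded_bilinear_matrix_mult])
  moreover have "?L \<subseteq> Cent A"
  proof
    fix S assume "S \<in> ?L"
    then obtain T where "T \<in> Cent A" and S: "S = T ** matrix_inv Z"
      using connected_component_subset by blast
    then have "det T \<noteq> 0" "A ** T = T ** A" by (auto simp: Cent_def GL_UNIV_iff)
    then show "S \<in> Cent A"
      using det_matrix_inv_nz[OF dZ] ZA unfolding S
      by (simp add: Cent_def GL_UNIV_iff det_mul) (metis matrix_mul_assoc)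
  qed
  moreover have "mat 1 \<in> ?L"
  proof -
    have "Z \<in> ?K" using ZC by simp
    then have "Z ** matrix_inv Z \<in> ?L" by blast
    then show ?thesis by (simp add: matrix_inv_works dZ)
  qed
  ultimately have "?L \<subseteq> connected_component_set (Cent A) (mat 1)"
    by (intro connected_component_maximal)
  then have "X ** matrix_inv Z \<in> connected_component_set (Cent A) (mat 1)" using X(2) by blast
  moreover have "X ** matrix_inv Z = (X ** V) ** matrix_inv Y"
    using dV dY by (simp add: Z_def matrix_inv_mult det_matrix_inv_nz matrix_inv_inv matrix_mul_assoc)
  ultimately have comp: "(X ** V) ** matrix_inv Y \<in> connected_component_set (Cent A) (mat 1)" by simp
  have "det (X ** V) \<noteq> 0" using dX dV by (simp add: det_mul)
  moreover have "A ** (X ** V) = (X ** V) ** B"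
    using AX AV by (metis matrix_mul_assoc)
  ultimately have "matrix_inv (X ** V) ** A ** (X ** V) = B"
    using conjugate_eq_iff by blast
  then show ?thesis
    using SSE_if_identity_component[OF U A C Y GL_mult[OF U(1) X(1) V(1)] _ comp] by blast
qed

theorem theorem5p10:
  fixes U :: "real set"
    and At :: "real \<Rightarrow> real^'n^'n"
    and A B :: "real^'n^'n"
  assumes "subring_of_reals U" and "unital_nondiscrete U"
    and "path At" and "At 0 = A" and "At 1 = B"
    and "\<And>t. t \<in> {0..1} \<Longrightarrow> positive_matrix (At t)"
    and "\<And>s t. s \<in> {0..1} \<Longrightarrow> t \<in> {0..1} \<Longrightarrow> conjugate_over UNIV (At s) (At t)"
  shows
    "SSE_through_positive (nonneg_part UNIV) A B
     \<and>
     (matrix_over U A \<and>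
      (\<exists>G :: real \<Rightarrow> real^'n^'n.
         path G \<and> (\<forall>t\<in>{0..1}. G t \<in> GL UNIV) \<and> G 0 = mat 1 \<and>
         (\<forall>t\<in>{0..1}. matrix_inv (G t) ** A ** G t = At t) \<and>
         (\<exists>W\<in>GL U. matrix_inv W ** A ** W = B \<and>
            W ** matrix_inv (G 1) \<in> connected_component_set (Cent A) (mat 1)))
      \<longrightarrow> SSE_through_positive (nonneg_part U) A B)
     \<and>
     (matrix_over U A \<and> matrix_over U B \<and> conjugate_over U A B \<and>
      (\<forall>K\<in>components (Cent A). \<exists>W\<in>GL U. W \<in> K)
      \<longrightarrow> SSE_through_positive (nonneg_part U) A B)
     \<and>
     (matrix_over U A \<and> matrix_over U B \<and> conjugate_over U A B \<and>
      ((\<forall>x\<in>U. x \<noteq> 0 \<longrightarrow> is_unit_in U x) \<or>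
       (\<exists>J. is_ideal_of J U \<and> J \<noteq> U \<and> (\<forall>x\<in>U - J. is_unit_in U x)))
      \<longrightarrow> SSE_through_positive (nonneg_part U) A B)"
proof -
  note U = assms(1,2) and At = assms(4,5) and pos = assms(6)
  have "continuous_on {0..1} At" using assms(3) by (simp add: path_def)
  moreover have "\<exists>G. det G \<noteq> 0 \<and> At s ** G = G ** At t" if "s \<in> {0..1}" "t \<in> {0..1}" for s t
  proof -
    obtain W where W: "W \<in> GL UNIV" "matrix_inv W ** At s ** W = At t"
      using assms(7)[OF \<open>s \<in> {0..1}\<close> \<open>t \<in> {0..1}\<close>] unfolding conjugate_over_def by blast
    then show ?thesis using conjugate_eq_iff GL_det_nz by blast
  qed
  ultimately obtain C Y where C: "connected C" "mat 1 \<in> C" "Y \<in> C" and Y: "At 0 ** Y = Y ** At 1"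
    and lift: "\<And>Z. Z \<in> C \<Longrightarrow> det Z \<noteq> 0 \<and> (\<exists>t\<in>{0..1}. At 0 ** Z = Z ** At t)"
    using connected_set_of_conjugators[of "{0..1}" At 0 1] by (metis atLeastAtMost_iff convex_real_interval(5) order_refl zero_le_one)
  have Cpos: "det Z \<noteq> 0 \<and> positive_matrix (matrix_inv Z ** A ** Z)" if "Z \<in> C" for Z
    using lift[OF that] pos At conjugate_eq_iff by metis
  have YB: "matrix_inv Y ** A ** Y = B"
    using Y Cpos[OF C(3)] At conjugate_eq_iff by blast
  \<comment> \<open>over the reals the conjugator \<open>Y\<close> may serve as \<open>W\<close>\<close>
  have part1: "SSE_through_positive (nonneg_part UNIV) A B"
  proof (rule SSE_if_identity_component[OF _ _ _ C Cpos YB _ YB])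
    show "Y ** matrix_inv Y \<in> connected_component_set (Cent A) (mat 1)"
      using Cpos[OF C(3)] by (simp add: matrix_inv_works Cent_def GL_UNIV_iff)
    show "Y \<in> GL UNIV" using Cpos[OF C(3)] by (simp add: GL_UNIV_iff)
  qed (auto simp: subring_of_reals_def unital_nondiscrete_def matrix_over_def)
  have part2: "SSE_through_positive (nonneg_part U) A B"
    if A: "matrix_over U A" and G: "path G" "\<forall>t\<in>{0..1}. G t \<in> GL UNIV" "G 0 = mat 1"
        "\<forall>t\<in>{0..1}. matrix_inv (G t) ** A ** G t = At t"
      and W: "W \<in> GL U" "matrix_inv W ** A ** W = B"
        "W ** matrix_inv (G 1) \<in> connected_component_set (Cent A) (mat 1)" for G W
  proof (rule SSE_if_identity_component[OF U A _ _ _ _ _ W])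
    show "connected (G ` {0..1})"
      using G(1) by (intro connected_continuous_image) (auto simp: path_def)
    show "mat 1 \<in> G ` {0..1}" using G(3) by (metis atLeastAtMost_iff imageI order_refl zero_le_one)
    show "G 1 \<in> G ` {0..1}" by simp
    show "det Z \<noteq> 0 \<and> positive_matrix (matrix_inv Z ** A ** Z)" if "Z \<in> G ` {0..1}" for Z
      using that G(2,4) pos by (auto simp: GL_UNIV_iff)
    show "matrix_inv (G 1) ** A ** G 1 = B" using G(4) At by simp
  qed
  have part3: "SSE_through_positive (nonneg_part U) A B"
    if "matrix_over U A" "conjugate_over U A B" "\<forall>K\<in>components (Cent A). \<exists>W\<in>GL U. W \<in> K"
    using SSE_if_components_meet_GL[OF U that(1) C Cpos YB that(2)] that(3) by blast
  have part4: "SSE_through_positive (nonneg_part U) A B"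
    if A: "matrix_over U A" and AB: "conjugate_over U A B"
      and loc: "(\<forall>x\<in>U. x \<noteq> 0 \<longrightarrow> is_unit_in U x) \<or>
        (\<exists>J. is_ideal_of J U \<and> J \<noteq> U \<and> (\<forall>x\<in>U - J. is_unit_in U x))"
  proof -
    \<comment> \<open>the zero ideal brings the case of a field under the local one\<close>
    have "is_ideal_of {0} U" "{0} \<noteq> U"
      using U by (auto simp: is_ideal_of_def subring_of_reals_def unital_nondiscrete_def)
    then obtain J where "is_ideal_of J U" "J \<noteq> U" "\<forall>x\<in>U - J. is_unit_in U x"
      using loc by blast
    then show ?thesis
      using part3[OF A AB] centralizer_component_meets_GL[OF U A] by blast
  qed
  show ?thesis using part1 part2 part3 part4 by blast
qed

end
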